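(* For any $n\times n$ skew-symmetrizable matrix $B$ and any mutation data $(\mathbf d,\mathbf z)$, every $c$-vector $c^t_i$ ($t$ a vertex of $\mathbb T_n$, $1\le i\le n$) of the $(\mathbf d,\mathbf z)$-cluster pattern with principal coefficients and initial seed $(\mathbf x,\mathbf y,B)$ is sign-coherent: it is nonzero and its components are either all nonnegative or all nonpositive.
   Context: $[a]_+=\max(a,0)$; all matrices integer; $B=(b_{ij})$ skew-symmetrizable means positive integers $\delta_i$ with $\delta_ib_{ij}=-\delta_jb_{ji}$ exist. Mutation data: positive integers $\mathbf d=(d_1,\dots,d_n)$ and frozen coefficients $z_{i,s}$ ($1\le s\le d_i-1$), $z_{i,s}=z_{i,d_i-s}$, $z_{i,0}=z_{i,d_i}=1$. For formal variables $y_1,\dots,y_n$, $z_{i,s}$, $\mathrm{Trop}(\mathbf y,\mathbf z)$ is the free abelian multiplicative group they generate with $\oplus$ the componentwise minimum of exponents. The $(\mathbf d,\mathbf z)$-mutation at $k$ acts on exchange matrices and $y$-variables by: $b'_{ij}=-b_{ij}$ if $i=k$ or $j=k$, else $b'_{ij}=b_{ij}+d_k([-b_{ik}]_+b_{kj}+b_{ik}[b_{kj}]_+)$; $y'_k=y_k^{-1}$, $y'_i=y_i(y_k^{[\varepsilon b_{ki}]_+})^{d_k}(\bigoplus_{s=0}^{d_k}z_{k,s}y_k^{\varepsilon s})^{-b_{ki}}$ ($i\ne k$), $\varepsilon=\pm1$ (cluster variables also mutate, irrelevant here). $\mathbb T_n$ is the $n$-regular tree with edges labeled $1,\dots,n$,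 distinct labels at each vertex; the pattern with principal coefficients assigns seeds in $\mathrm{Trop}(\mathbf y,\mathbf z)$ to vertices, related by mutation at $k$ along edges labeled $k$, with $B$ and $y$-variables $y_1,\dots,y_n$ (the generators) at a fixed vertex $t_0$. Each $y$-variable $y^t_j$ is a Laurent monomial $\prod_iy_i^{c^t_{ij}}$ in $\mathbf y$ alone, and $c^t_j=(c^t_{1j},\dots,c^t_{nj})$ is the $c$-vector. *)

theory Defs
  imports Main
begin

text \<open>Indices run over 1..n. The exchange matrix is a function nat => nat => int
(only entries with indices in 1..n matter).\<close>

definition pos :: "int \<Rightarrow> int" where "pos a = max a 0"

definition skew_symmetrizable :: "nat \<Rightarrow> (nat \<Rightarrow> nat \<Rightarrow> int) \<Rightarrow> bool" where
  "skew_symmetrizable n B \<longleftrightarrow>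
     (\<exists>\<delta>::nat \<Rightarrow> int. (\<forall>i\<in>{1..n}. \<delta> i > 0) \<and>
        (\<forall>i\<in>{1..n}. \<forall>j\<in>{1..n}. \<delta> i * B i j = - (\<delta> j * B j i)))"

text \<open>Elements of Trop(y,z): the free abelian group on generators y_i and z_{i,s}.
An element is represented by its exponent vector: y-exponents (indexed by i) and
z-exponents (indexed by (i,s)); because z_{i,s} = z_{i,d_i-s}, the generator z_{i,s}
(1 <= s <= d_i - 1) is represented by the index (i, min s (d_i - s)).
Multiplication = addition of exponents, tropical sum = componentwise minimum.\<close>

type_synonym trop = "(nat \<Rightarrow> int) \<times> (nat \<Rightarrow> nat \<Rightarrow> int)"

definition tone :: trop where "tone = (\<lambda>_. 0, \<lambda>_ _. 0)"

definition tmul :: "trop \<Rightarrow> trop \<Rightarrow> trop" where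
  "tmul a b = (\<lambda>i. fst a i + fst b i, \<lambda>i s. snd a i s + snd b i s)"

definition tpow :: "trop \<Rightarrow> int \<Rightarrow> trop" where
  "tpow a m = (\<lambda>i. m * fst a i, \<lambda>i s. m * snd a i s)"

definition tplus :: "trop \<Rightarrow> trop \<Rightarrow> trop" where
  "tplus a b = (\<lambda>i. min (fst a i) (fst b i), \<lambda>i s. min (snd a i s) (snd b i s))"

definition ygen :: "nat \<Rightarrow> trop" where
  "ygen i = (\<lambda>j. if j = i then 1 else 0, \<lambda>_ _. 0)"

definition zgen :: "(nat \<Rightarrow> nat) \<Rightarrow> nat \<Rightarrow> nat \<Rightarrow> trop" where
  "zgen d k s = (if s = 0 \<or> d k \<le> s then tone
       else (\<lambda>_. 0, \<lambda>i t. if i = k \<and> t = min s (d k - s) then 1 else 0))"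

text \<open>Tropical sum  (+)_{s=0}^{d_k} z_{k,s} y_k^{eps s}  (with eps = 1).\<close>
definition zsum :: "(nat \<Rightarrow> nat) \<Rightarrow> trop \<Rightarrow> nat \<Rightarrow> trop" where
  "zsum d yk k = fold tplus (map (\<lambda>s. tmul (zgen d k s) (tpow yk (int s))) [1..<d k + 1])
                   (tmul (zgen d k 0) (tpow yk 0))"

definition mut_matrix :: "(nat \<Rightarrow> nat) \<Rightarrow> nat \<Rightarrow> (nat \<Rightarrow> nat \<Rightarrow> int) \<Rightarrow> (nat \<Rightarrow> nat \<Rightarrow> int)" where
  "mut_matrix d k B = (\<lambda>i j. if i = k \<or> j = k then - B i j
      else B i j + int (d k) * (pos (- B i k) * B k j + B i k * pos (B k j)))"

text \<open>(d,z)-mutation at k of the y-variables (with sign eps = 1).\<close>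
definition mut_y :: "(nat \<Rightarrow> nat) \<Rightarrow> nat \<Rightarrow> (nat \<Rightarrow> nat \<Rightarrow> int) \<Rightarrow> (nat \<Rightarrow> trop) \<Rightarrow> (nat \<Rightarrow> trop)" where
  "mut_y d k B y = (\<lambda>i. if i = k then tpow (y k) (-1)
      else tmul (tmul (y i) (tpow (tpow (y k) (pos (B k i))) (int (d k))))
                (tpow (zsum d (y k) k) (- B k i)))"

definition mut_seed :: "(nat \<Rightarrow> nat) \<Rightarrow> nat \<Rightarrow> (nat \<Rightarrow> nat \<Rightarrow> int) \<times> (nat \<Rightarrow> trop)
                         \<Rightarrow> (nat \<Rightarrow> nat \<Rightarrow> int) \<times> (nat \<Rightarrow> trop)" where
  "mut_seed d k S = (mut_matrix d k (fst S), mut_y d k (fst S) (snd S))"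

text \<open>Vertices of the n-regular tree T_n are identified with the reduced words
k_1 ... k_m (labels in 1..n, no two consecutive labels equal) labelling the unique
path from t_0; the seed at such a vertex is obtained by mutating successively at
k_1, ..., k_m starting from the initial seed.\<close>

definition tree_vertex :: "nat \<Rightarrow> nat list \<Rightarrow> bool" where
  "tree_vertex n ks \<longleftrightarrow> set ks \<subseteq> {1..n} \<and> (\<forall>i. Suc i < length ks \<longrightarrow> ks ! i \<noteq> ks ! Suc i)"

definition principal_seed :: "(nat \<Rightarrow> nat) \<Rightarrow> (nat \<Rightarrow> nat \<Rightarrow> int) \<Rightarrow> nat list
                               \<Rightarrow> (nat \<Rightarrow> nat \<Rightarrow> int) \<times> (nat \<Rightarrow> trop)" where
  "principal_seed d B ks = foldl (\<lambda>S k. mut_seed d k S) (B, ygen) ks"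

definition c_vector :: "(nat \<Rightarrow> nat) \<Rightarrow> (nat \<Rightarrow> nat \<Rightarrow> int) \<Rightarrow> nat list \<Rightarrow> nat \<Rightarrow> nat \<Rightarrow> int" where
  "c_vector d B ks j = (\<lambda>i. fst (snd (principal_seed d B ks) j) i)"

end

(* The (d,z)-mutation is the ordinary mutation of the skew-symmetrizable matrix b = (d_i b_ij), so ordinary c-vectors are
   at stake. Read tropically, sign-coherence at all vertices follows once no y-variable ever vanishes at a positive
   integral point x of the initial seed: the y-variable is then a nowhere vanishing linear form on the positive orthant.

   That non-vanishing is proved by a consistent scattering diagram, encoded as one series g in the quantum torus algebra
   with commutation form omega(e_i,e_j) = delta_i b_ij. Each functional x on degrees factors g uniquely as a product of
   series of positive, zero and negative x-degree; the middle factor is the wall function at x. One recursion on degrees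
   produces the g whose wall function at omega(n,.) has no logarithmic part in degree n, except for the quantum
   dilogarithms E_i in the multiples of e_i. Write g = E_k h' = h E_k. The defining conditions bound the exponent of X_k
   in h' and h, so that reversing X_k inside these bounds yields such a series for the mutated seed. Under this
   operation wall functions follow the tropical mutation of x. A positive x lies on no wall, hence neither do its
   images; but every x with x_i = 0 lies on the wall of E_i. *)

theory Submission
  imports Defs "HOL-Library.Multiset" "HOL-Computational_Algebra.Formal_Power_Series"
begin

text \<open>The obstacle is that mutation inverts \<open>X_k\<close>, and a power series in
  \<open>X_k\<close> that does not terminate cannot be reversed. In each fixed degree of the other
  variables, however, h' and h differ by a quotient of two rescaled dilogarithms, which is a finite
  product. A bound on one side thus passes to the other, and since the product is palindromic, the
  reversals on the two sides of \<open>E_k\<close> lead to the same mutated series. Logarithms of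
  wall functions are not additive, because these functions need not commute. The degree-n part at
  \<omega>(n,.) is a trace and therefore additive; the condition on g is imposed on this part alone.
  Factoring along arbitrary functionals x, not only along those of the form \<omega>(n,.), brings
  degenerate matrices within reach. A point evaluated on the y-variables follows tropical mutation
  only where the mutating column is already sign-coherent. Nonvanishing and coherence are therefore
  carried through a single induction along the path, with one series serving all positive x at
  once.\<close>

section \<open>Degrees, functionals and the commutation form\<close>

definition wt :: "('i \<Rightarrow> int) \<Rightarrow> 'i multiset \<Rightarrow> int" where
  "wt x m = (\<Sum>i\<in>#m. x i)"

text \<open>The functional \<omega>(a,.): a degree turned into a point at which a series can be
  factored.\<close>

definition col :: "('i \<Rightarrow> 'i \<Rightarrow> int) \<Rightarrow> 'i multiset \<Rightarrow> 'i \<Rightarrow> int" where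
  "col w a j = wt (\<lambda>i. w i j) a"

definition pair :: "('i \<Rightarrow> 'i \<Rightarrow> int) \<Rightarrow> 'i multiset \<Rightarrow> 'i multiset \<Rightarrow> int" where
  "pair w a b = wt (col w a) b"

definition skew :: "('i \<Rightarrow> 'i \<Rightarrow> int) \<Rightarrow> bool" where
  "skew w \<longleftrightarrow> (\<forall>i j. w i j = - w j i)"

lemma wt_simps [simp]:
  "wt x {#} = 0" "wt x (a + b) = wt x a + wt x b" "wt x (add_mset i a) = x i + wt x a"
  "wt x (replicate_mset n i) = int n * x i"
  by (simp_all add: wt_def)

lemma wt_fun:
  "wt (\<lambda>i. x i + y i) m = wt x m + wt y m" "wt (\<lambda>i. - x i) m = - wt x m"
  "wt (\<lambda>i. c * x i) m = c * wt x m"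
  by (induction m) (simp_all add: algebra_simps)

lemma wt_cong: "(\<And>i. i \<in># m \<Longrightarrow> x i = y i) \<Longrightarrow> wt x m = wt y m"
  by (induction m) simp_all

lemma pair_simps [simp]:
  "pair w {#} b = 0" "pair w a {#} = 0"
  "pair w (a + a') b = pair w a b + pair w a' b" "pair w a (b + b') = pair w a b + pair w a b'"
proof -
  have *: "col w {#} = (\<lambda>_. 0)" "col w (a + a') = (\<lambda>j. col w a j + col w a' j)"
    by (simp_all add: col_def fun_eq_iff)
  show "pair w {#} b = 0" using wt_fun(3)[of 0 "\<lambda>_. 0" b] by (simp add: pair_def *)
  show "pair w (a + a') b = pair w a b + pair w a' b" by (simp add: pair_def * wt_fun)
qed (simp_all add: pair_def)

lemma skew_uminus: "skew w \<Longrightarrow> skew (\<lambda>i j. - w i j)"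
  unfolding skew_def by metis

lemma col_uminus: "col (\<lambda>i j. - w i j) a = (\<lambda>j. - col w a j)"
  by (simp add: col_def fun_eq_iff wt_fun)

lemma pair_uminus: "pair (\<lambda>i j. - w i j) a b = - pair w a b"
  by (simp add: pair_def col_uminus wt_fun)

lemma pair_single: "pair w {#i#} b = wt (w i) b"
  by (simp add: pair_def col_def cong: wt_cong)

lemma pair_skew: "skew w \<Longrightarrow> pair w a b = - pair w b a"
proof (induction a)
  case (add i a)
  have "w i = (\<lambda>j. - w j i)" using add.prems unfolding skew_def by blast
  then have "wt (w i) b = - col w b i" by (simp only: col_def wt_fun)
  moreover have "pair w b {#i#} = col w b i" by (simp add: pair_def)
  moreover have "pair w (add_mset i a) b = wt (w i) b + pair w a b"
    using pair_simps(3)[of w "{#i#}" a b] by (simp add: pair_single)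
  moreover have "pair w b (add_mset i a) = pair w b {#i#} + pair w b a"
    using pair_simps(4)[of w b "{#i#}" a] by simp
  ultimately show ?case using add.IH[OF add.prems] by linarith
qed simp

definition splits :: "'i multiset \<Rightarrow> ('i multiset \<times> 'i multiset) set" where
  "splits m = {(a, b). a + b = m}"

lemma in_splits [simp]: "(a, b) \<in> splits m \<longleftrightarrow> a + b = m"
  by (simp add: splits_def)

lemma finite_splits [simp]: "finite (splits m)"
proof (induction m)
  case empty
  then show ?case by (simp add: splits_def)
next
  case (add x m)
  have "splits (add_mset x m) \<subseteq> (\<lambda>(a, b). (add_mset x a, b)) ` splits m \<union> (\<lambda>(a, b). (a, add_mset x b)) ` splits m"
  proof
    fix p assume "p \<in> splits (add_mset x m)"
    then obtain a b where p: "p = (a, b)" and ab: "a + b = add_mset x m" by (cases p) auto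
    then have "x \<in># a \<or> x \<in># b" by (metis union_iff union_single_eq_member)
    then show "p \<in> (\<lambda>(a, b). (add_mset x a, b)) ` splits m \<union> (\<lambda>(a, b). (a, add_mset x b)) ` splits m"
    proof
      assume "x \<in># a"
      then obtain a' where "a = add_mset x a'" by (metis mset_add)
      then show ?thesis using p ab by force
    next
      assume "x \<in># b"
      then obtain b' where "b = add_mset x b'" by (metis mset_add)
      then show ?thesis using p ab by force
    qed
  qed
  then show ?case using add finite_subset by blast
qed

section \<open>The quantum torus algebra\<close>

type_synonym 'i ser = "'i multiset \<Rightarrow> real"

text \<open>The rule is X_a X_b = 2^{w(a,b)} X_{a+b}. The quantum parameter is the number 2 instead
  of an indeterminate: coefficients stay real, and 2 > 1 keeps the denominators of the quantum
  dilogarithms nonzero.\<close>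

definition mul :: "('i \<Rightarrow> 'i \<Rightarrow> int) \<Rightarrow> 'i ser \<Rightarrow> 'i ser \<Rightarrow> 'i ser" where
  "mul w f g m = (\<Sum>(a, b)\<in>splits m. 2 powi pair w a b * (f a * g b))"

definition one :: "'i ser" where
  "one m = (if m = {#} then 1 else 0)"

lemma one_empty [simp]: "one {#} = 1" by (simp add: one_def)

lemma splits_empty [simp]: "splits {#} = {({#}, {#})}"
  by (auto simp: splits_def)

lemma mul_empty [simp]: "mul w f g {#} = f {#} * g {#}"
  by (simp add: mul_def)

lemma powi2_add: "(2::real) powi (i + j) = 2 powi i * 2 powi j"
  by (simp add: power_int_add)

lemma mul_eq: "mul w f g m = (\<Sum>p\<in>splits m. 2 powi pair w (fst p) (snd p) * (f (fst p) * g (snd p)))"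
  by (simp add: mul_def case_prod_unfold)

lemma splits_assoc:
  "(\<Sum>p\<in>splits m. \<Sum>q\<in>splits (fst p). F (fst q) (snd q) (snd p)) =
   (\<Sum>p\<in>splits m. \<Sum>q\<in>splits (snd p). F (fst p) (fst q) (snd q))"
  unfolding sum.Sigma[OF finite_splits ballI[OF finite_splits]]
  by (rule sum.reindex_bij_witness[of _ "\<lambda>((a, u), (b, c)). ((a + b, c), (a, b))" "\<lambda>((u, c), (a, b)). ((a, b + c), (b, c))"])
    (auto simp: add.assoc)

lemma mul_assoc: "mul w (mul w f g) h = mul w f (mul w g h)"
proof
  fix m :: "'a multiset"
  let ?F = "\<lambda>a b c. 2 powi (pair w a b + pair w a c + pair w b c) * (f a * g b * h c)"
  have "mul w (mul w f g) h m = (\<Sum>p\<in>splits m. \<Sum>q\<in>splits (fst p). ?F (fst q) (snd q) (snd p))"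
    unfolding mul_eq[of w "mul w f g"]
  proof (intro sum.cong refl)
    fix p assume "p \<in> splits m"
    show "2 powi pair w (fst p) (snd p) * (mul w f g (fst p) * h (snd p))
      = (\<Sum>q\<in>splits (fst p). ?F (fst q) (snd q) (snd p))"
      unfolding mul_eq sum_distrib_left sum_distrib_right
    proof (intro sum.cong refl)
      fix q assume "q \<in> splits (fst p)"
      then have "fst p = fst q + snd q" by (cases q) auto
      then show "2 powi pair w (fst p) (snd p) * (2 powi pair w (fst q) (snd q) * (f (fst q) * g (snd q)) * h (snd p))
        = ?F (fst q) (snd q) (snd p)" by (simp add: powi2_add)
    qed
  qed
  also have "\<dots> = (\<Sum>p\<in>splits m. \<Sum>q\<in>splits (snd p). ?F (fst p) (fst q) (snd q))"
    by (rule splits_assoc)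
  also have "\<dots> = mul w f (mul w g h) m"
    unfolding mul_eq[of w f]
  proof (intro sum.cong refl)
    fix p assume "p \<in> splits m"
    show "(\<Sum>q\<in>splits (snd p). ?F (fst p) (fst q) (snd q))
      = 2 powi pair w (fst p) (snd p) * (f (fst p) * mul w g h (snd p))"
      unfolding mul_eq sum_distrib_left
    proof (intro sum.cong refl)
      fix q assume "q \<in> splits (snd p)"
      then have "snd p = fst q + snd q" by (cases q) auto
      then show "?F (fst p) (fst q) (snd q)
        = 2 powi pair w (fst p) (snd p) * (f (fst p) * (2 powi pair w (fst q) (snd q) * (g (fst q) * h (snd q))))"
        by (simp add: powi2_add)
    qed
  qed
  finally show "mul w (mul w f g) h m = mul w f (mul w g h) m" .
qed

lemma mul_one [simp]: "mul w one f = f" "mul w f one = f"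
proof -
  show "mul w one f = f"
  proof
    fix m
    have "mul w one f m = (\<Sum>(a, b)\<in>{({#}, m)}. 2 powi pair w a b * (one a * f b))"
      unfolding mul_def by (rule sum.mono_neutral_right) (auto simp: one_def split: if_splits)
    then show "mul w one f m = f m" by simp
  qed
  show "mul w f one = f"
  proof
    fix m
    have "mul w f one m = (\<Sum>(a, b)\<in>{(m, {#})}. 2 powi pair w a b * (f a * one b))"
      unfolding mul_def by (rule sum.mono_neutral_right) (auto simp: one_def split: if_splits)
    then show "mul w f one m = f m" by simp
  qed
qed

lemma mul_add_left: "mul w (\<lambda>m. f m + g m) h = (\<lambda>m. mul w f h m + mul w g h m)"
  by (simp add: mul_def fun_eq_iff algebra_simps case_prod_unfold sum.distrib)

lemma mul_add_right: "mul w h (\<lambda>m. f m + g m) = (\<lambda>m. mul w h f m + mul w h g m)"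
  by (simp add: mul_def fun_eq_iff algebra_simps case_prod_unfold sum.distrib)

text \<open>Negating a skew form gives the opposite algebra. Statements about left multiplication
  thereby yield their mirror images for right multiplication.\<close>

lemma mul_opp:
  assumes "skew w" shows "mul (\<lambda>i j. - w i j) f g = mul w g f"
proof
  fix m
  show "mul (\<lambda>i j. - w i j) f g m = mul w g f m"
    unfolding mul_def
    by (rule sum.reindex_bij_witness[of _ prod.swap prod.swap])
      (auto simp: pair_uminus pair_skew[OF assms, symmetric] add.commute)
qed

subsection \<open>Supports\<close>

definition supported :: "'i ser \<Rightarrow> 'i multiset set \<Rightarrow> bool" where
  "supported f S \<longleftrightarrow> (\<forall>m. m \<notin> S \<longrightarrow> f m = 0)"

definition submonoid :: "'i multiset set \<Rightarrow> bool" where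
  "submonoid S \<longleftrightarrow> {#} \<in> S \<and> (\<forall>a\<in>S. \<forall>b\<in>S. a + b \<in> S)"

lemma supported_mono: "supported f S \<Longrightarrow> S \<subseteq> T \<Longrightarrow> supported f T"
  by (auto simp: supported_def)

lemma supported_mul:
  assumes "supported f A" "supported g B" "\<And>a b. a \<in> A \<Longrightarrow> b \<in> B \<Longrightarrow> a + b \<in> C"
  shows "supported (mul w f g) C"
  unfolding supported_def mul_def
proof (intro allI impI sum.neutral ballI)
  fix m p assume "m \<notin> C" "p \<in> splits m"
  moreover obtain a b where ab: "p = (a, b)" by (cases p)
  ultimately have "a \<notin> A \<or> b \<notin> B" using assms(3)[of a b] by auto
  then show "(case p of (a, b) \<Rightarrow> 2 powi pair w a b * (f a * g b)) = 0"
    using assms(1,2) ab by (auto simp: supported_def)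
qed

lemma supported_mul_submonoid: "supported f S \<Longrightarrow> supported g S \<Longrightarrow> submonoid S \<Longrightarrow> supported (mul w f g) S"
  by (erule supported_mul) (auto simp: submonoid_def)

lemma mul_split:
  assumes "m \<noteq> {#}"
  shows "mul w f g m = f m * g {#} + f {#} * g m
    + (\<Sum>(a, b)\<in>splits m - {(m, {#}), ({#}, m)}. 2 powi pair w a b * (f a * g b))"
proof -
  have "mul w f g m = (\<Sum>(a, b)\<in>{(m, {#}), ({#}, m)}. 2 powi pair w a b * (f a * g b))
    + (\<Sum>(a, b)\<in>splits m - {(m, {#}), ({#}, m)}. 2 powi pair w a b * (f a * g b))"
    unfolding mul_def by (subst sum.subset_diff[of "{(m, {#}), ({#}, m)}" "splits m"]) auto
  then show ?thesis using assms by simp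
qed

text \<open>A degree that cannot be split inside the common support sees the product only to first
  order, so its coefficient can be solved for.\<close>

lemma mul_indec:
  assumes "m \<noteq> {#}" "supported f S" "supported g S"
    and "\<And>a b. a \<in> S \<Longrightarrow> b \<in> S \<Longrightarrow> a + b = m \<Longrightarrow> a = {#} \<or> b = {#}"
  shows "mul w f g m = f m * g {#} + f {#} * g m"
proof -
  have "(\<Sum>(a, b)\<in>splits m - {(m, {#}), ({#}, m)}. 2 powi pair w a b * (f a * g b)) = 0"
  proof (intro sum.neutral ballI)
    fix p assume p: "p \<in> splits m - {(m, {#}), ({#}, m)}"
    obtain a b where ab: "p = (a, b)" by (cases p)
    have "a \<notin> S \<or> b \<notin> S" using p ab assms(4)[of a b] by auto
    then show "(case p of (a, b) \<Rightarrow> 2 powi pair w a b * (f a * g b)) = 0"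
      using assms(2,3) ab by (auto simp: supported_def)
  qed
  then show ?thesis using mul_split[OF assms(1), of w f g] by simp
qed

definition agree :: "nat \<Rightarrow> 'i ser \<Rightarrow> 'i ser \<Rightarrow> bool" where
  "agree d f g \<longleftrightarrow> (\<forall>m. size m < d \<longrightarrow> f m = g m)"

lemma agree_mono: "agree d f g \<Longrightarrow> d' \<le> d \<Longrightarrow> agree d' f g"
  by (simp add: agree_def)

lemma mul_diff:
  assumes "agree (size m) f f'" "agree (size m) g g'" "m \<noteq> {#}"
  shows "mul w f g m - mul w f' g' m = (f m - f' m) * g {#} + f {#} * (g m - g' m)"
proof -
  have 0: "f' {#} = f {#}" "g' {#} = g {#}"
    using assms by (auto simp: agree_def nonempty_has_size)
  have "(\<Sum>(a, b)\<in>splits m - {(m, {#}), ({#}, m)}. 2 powi pair w a b * (f a * g b))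
    = (\<Sum>(a, b)\<in>splits m - {(m, {#}), ({#}, m)}. 2 powi pair w a b * (f' a * g' b))"
  proof (intro sum.cong refl)
    fix p assume p: "p \<in> splits m - {(m, {#}), ({#}, m)}"
    obtain a b where ab: "p = (a, b)" by (cases p)
    have m: "m = a + b" "a \<noteq> {#}" "b \<noteq> {#}" using p ab by auto
    then have "size a < size m" "size b < size m" by (simp_all add: nonempty_has_size)
    then show "(case p of (a, b) \<Rightarrow> 2 powi pair w a b * (f a * g b)) = (case p of (a, b) \<Rightarrow> 2 powi pair w a b * (f' a * g' b))"
      using assms(1,2) ab by (auto simp: agree_def)
  qed
  then show ?thesis
    using 0 mul_split[OF assms(3), of w f g] mul_split[OF assms(3), of w f' g'] by (simp add: algebra_simps)
qed

lemma mul_agree: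
  assumes "agree d f f'" "agree d g g'"
  shows "agree d (mul w f g) (mul w f' g')"
  unfolding agree_def
proof (intro allI impI)
  fix m :: "'a multiset" assume m: "size m < d"
  show "mul w f g m = mul w f' g' m"
  proof (cases "m = {#}")
    case True
    then show ?thesis using assms m by (simp add: agree_def)
  next
    case False
    have "mul w f g m - mul w f' g' m = (f m - f' m) * g {#} + f {#} * (g m - g' m)"
      by (rule mul_diff) (use assms m False in \<open>auto intro: agree_mono\<close>)
    then show ?thesis using assms m by (simp add: agree_def)
  qed
qed

text \<open>Round \<open>d\<close> of the iteration settles every degree of size below
  \<open>d\<close>, so the value at \<open>m\<close> is read off after \<open>Suc (size m)\<close>
  rounds. All recursions on degrees are instances of this.\<close>

lemma contraction_fixpoint:
  fixes \<Phi> :: "'i ser \<Rightarrow> 'i ser"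
  assumes "\<And>f g m. agree (size m) f g \<Longrightarrow> \<Phi> f m = \<Phi> g m"
  shows "\<exists>f. \<Phi> f = f"
proof -
  define F where "F d = (\<Phi> ^^ d) (\<lambda>_. 0)" for d
  have FS: "F (Suc d) = \<Phi> (F d)" for d by (simp add: F_def)
  have step: "agree d (F d) (F (Suc d))" for d
  proof (induction d)
    case 0
    then show ?case by (simp add: agree_def)
  next
    case (Suc d)
    have "\<Phi> (F d) m = \<Phi> (F (Suc d)) m" if "size m < Suc d" for m
      by (rule assms, rule agree_mono[OF Suc]) (use that in simp)
    then show ?case by (simp add: agree_def FS)
  qed
  have ag: "d \<le> e \<Longrightarrow> agree d (F d) (F e)" for d e
  proof (induction e rule: dec_induct)
    case base
    then show ?case by (simp add: agree_def)
  next
    case (step e)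
    then show ?case using \<open>\<And>d. agree d (F d) (F (Suc d))\<close>[of e] by (simp add: agree_def)
  qed
  define f where "f m = F (Suc (size m)) m" for m
  have "\<Phi> f m = f m" for m
  proof -
    have "agree (size m) f (F (size m))"
      unfolding agree_def f_def
    proof (intro allI impI)
      fix l :: "'i multiset" assume "size l < size m"
      then show "F (Suc (size l)) l = F (size m) l"
        using ag[of "Suc (size l)" "size m"] by (auto simp: agree_def)
    qed
    then have "\<Phi> f m = \<Phi> (F (size m)) m" by (rule assms)
    then show ?thesis by (simp add: f_def FS)
  qed
  then show ?thesis by blast
qed

lemma submonoid_cut: "submonoid S \<Longrightarrow> submonoid (S \<union> {l. d \<le> size l})"
  by (auto simp: submonoid_def)

text \<open>For support proofs by induction on size: below \<open>size m\<close> a series is known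
  to live in \<open>S\<close>, and from there on nothing is assumed. Two nonempty parts of
  \<open>m\<close> are smaller, hence in \<open>S\<close>, and would put \<open>m\<close> into
  \<open>S\<close>.\<close>

lemma indec_cut:
  assumes "m \<notin> S" "submonoid S" "a \<in> S \<union> {l. size m \<le> size l}" "b \<in> S \<union> {l. size m \<le> size l}" "a + b = m"
  shows "a = {#} \<or> b = {#}"
proof (rule ccontr)
  assume "\<not> (a = {#} \<or> b = {#})"
  then have "size a < size m" "size b < size m" using assms(5) by (auto simp: nonempty_has_size)
  then show False using assms by (auto simp: submonoid_def)
qed

subsection \<open>Inverses\<close>

definition winv :: "('i \<Rightarrow> 'i \<Rightarrow> int) \<Rightarrow> 'i ser \<Rightarrow> 'i ser" where
  "winv w f = (SOME g. mul w f g = one \<and> mul w g f = one)"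

lemma right_inverse_exists:
  assumes "f {#} = 1"
  shows "\<exists>g. mul w f g = one"
proof -
  \<comment> \<open>As the constant term of \<open>f\<close> is 1, the bracket no longer involves
    \<open>g m\<close>; a fixed point solves the equation.\<close>
  define \<Phi> where "\<Phi> g m = one m - (mul w f g m - g m)" for g m
  have "\<Phi> g m = \<Phi> g' m" if "agree (size m) g g'" for g g' m
  proof (cases "m = {#}")
    case False
    have "mul w f g m - mul w f g' m = (f m - f m) * g {#} + f {#} * (g m - g' m)"
      by (rule mul_diff) (use that False in \<open>auto simp: agree_def\<close>)
    then show ?thesis using assms by (simp add: \<Phi>_def)
  qed (use assms in \<open>simp add: \<Phi>_def\<close>)
  from contraction_fixpoint[of \<Phi>, OF this] obtain g where g: "\<Phi> g = g" by blast
  have "mul w f g m = one m" for m using fun_cong[OF g, of m] by (simp add: \<Phi>_def)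
  then show ?thesis by blast
qed

lemma winv:
  assumes "f {#} = 1"
  shows "mul w f (winv w f) = one" "mul w (winv w f) f = one" "winv w f {#} = 1"
proof -
  obtain g where g: "mul w f g = one" using right_inverse_exists[of f w] assms by blast
  have "g {#} = 1" using fun_cong[OF g, of "{#}"] assms by simp
  then obtain h where h: "mul w g h = one" using right_inverse_exists by blast
  have "f = mul w (mul w f g) h" by (simp add: mul_assoc h)
  then have "f = h" by (simp add: g)
  then have *: "mul w f (winv w f) = one \<and> mul w (winv w f) f = one"
    unfolding winv_def using someI[of "\<lambda>g. mul w f g = one \<and> mul w g f = one" g] g h by simp
  then show "mul w f (winv w f) = one" "mul w (winv w f) f = one" by auto
  show "winv w f {#} = 1" using assms fun_cong[OF conjunct1[OF *], of "{#}"] by simp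
qed

lemma winv_left [simp]: "f {#} = 1 \<Longrightarrow> mul w (winv w f) (mul w f g) = g"
  by (simp add: mul_assoc[symmetric] winv)

lemma winv_right [simp]: "f {#} = 1 \<Longrightarrow> mul w f (mul w (winv w f) g) = g"
  by (simp add: mul_assoc[symmetric] winv)

lemma winv_unique: "f {#} = 1 \<Longrightarrow> mul w f g = one \<Longrightarrow> winv w f = g"
  using winv_left[of f w g] by simp

lemma winv_mul:
  assumes "f {#} = 1" "g {#} = 1"
  shows "winv w (mul w f g) = mul w (winv w g) (winv w f)"
  by (rule winv_unique) (use assms in \<open>simp_all add: mul_assoc winv\<close>)

lemma winv_opp:
  assumes "skew w" "f {#} = 1"
  shows "winv (\<lambda>i j. - w i j) f = winv w f"
  by (rule winv_unique) (use assms in \<open>simp_all add: mul_opp winv\<close>)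

lemma supported_winv:
  assumes "supported f S" "submonoid S" "f {#} = 1"
  shows "supported (winv w f) S"
  unfolding supported_def
proof (intro allI)
  fix m show "m \<notin> S \<longrightarrow> winv w f m = 0"
  proof (induction "size m" arbitrary: m rule: less_induct)
    case less
    show ?case
    proof
      assume m: "m \<notin> S"
      let ?T = "S \<union> {l. size m \<le> size l}"
      have ne: "m \<noteq> {#}" using m assms(2) by (auto simp: submonoid_def)
      have "supported f ?T" using assms(1) by (rule supported_mono) auto
      moreover have "supported (winv w f) ?T" using less by (auto simp: supported_def)
      ultimately have "mul w f (winv w f) m = f m * winv w f {#} + f {#} * winv w f m"
        using indec_cut[OF m assms(2)] by (rule mul_indec[OF ne])
      then show "winv w f m = 0"
        using assms m ne by (simp add: winv one_def supported_def)
    qed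
  qed
qed

lemma winv_agree:
  assumes "agree d f f'" "f {#} = 1" "f' {#} = 1"
  shows "agree d (winv w f) (winv w f')"
  unfolding agree_def
proof (intro allI)
  fix m show "size m < d \<longrightarrow> winv w f m = winv w f' m"
  proof (induction "size m" arbitrary: m rule: less_induct)
    case less
    show ?case
    proof
      assume m: "size m < d"
      show "winv w f m = winv w f' m"
      proof (cases "m = {#}")
        case True
        then show ?thesis using assms by (simp add: winv)
      next
        case False
        have "mul w f (winv w f) m - mul w f' (winv w f') m
          = (f m - f' m) * winv w f {#} + f {#} * (winv w f m - winv w f' m)"
          by (rule mul_diff) (use assms m less False in \<open>auto simp: agree_def\<close>)
        then show ?thesis using assms m by (simp add: winv agree_def)
      qed
    qed
  qed
qed

subsection \<open>Factorizations\<close>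

definition pset :: "('i \<Rightarrow> int) \<Rightarrow> 'i multiset set" where "pset x = {m. m = {#} \<or> wt x m > 0}"
definition zset :: "('i \<Rightarrow> int) \<Rightarrow> 'i multiset set" where "zset x = {m. wt x m = 0}"
definition nset :: "('i \<Rightarrow> int) \<Rightarrow> 'i multiset set" where "nset x = {m. m = {#} \<or> wt x m < 0}"

definition factors :: "('i \<Rightarrow> 'i \<Rightarrow> int) \<Rightarrow> ('i \<Rightarrow> int) \<Rightarrow> 'i ser \<Rightarrow> 'i ser \<Rightarrow> 'i ser \<Rightarrow> 'i ser \<Rightarrow> bool" where
  "factors w x g a b c \<longleftrightarrow> a {#} = 1 \<and> b {#} = 1 \<and> c {#} = 1 \<and>
     supported a (pset x) \<and> supported b (zset x) \<and> supported c (nset x) \<and> g = mul w a (mul w b c)"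

lemma submonoid_sets: "submonoid (pset x)" "submonoid (zset x)" "submonoid (nset x)"
  by (auto simp: submonoid_def pset_def zset_def nset_def)

lemma supported_one: "submonoid S \<Longrightarrow> supported one S"
  by (auto simp: supported_def one_def submonoid_def)

lemma factors_sign:
  assumes "factors w x g a b c" "m \<noteq> {#}"
  shows "(wt x m > 0 \<longrightarrow> b m = 0 \<and> c m = 0) \<and> (wt x m = 0 \<longrightarrow> a m = 0 \<and> c m = 0) \<and>
    (wt x m < 0 \<longrightarrow> a m = 0 \<and> b m = 0)"
  using assms by (auto simp: factors_def supported_def pset_def zset_def nset_def)

lemma factors_opp:
  assumes "skew w" "factors w x g a b c"
  shows "factors (\<lambda>i j. - w i j) (\<lambda>i. - x i) g c b a"
  using assms unfolding factors_def
  by (auto simp: mul_opp mul_assoc pset_def nset_def zset_def wt_fun)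

lemma factors_exists:
  assumes "g {#} = 1"
  shows "\<exists>a b c. factors w x g a b c"
proof -
  define A where "A t m = (if m = {#} then 1 else if wt x m > 0 then t m else 0)" for t :: "'a ser" and m
  define B where "B t m = (if m = {#} then 1 else if wt x m = 0 then t m else 0)" for t :: "'a ser" and m
  define C where "C t m = (if m = {#} then 1 else if wt x m < 0 then t m else 0)" for t :: "'a ser" and m
  \<comment> \<open>One series \<open>t\<close> stores all three factors: the sign of
    \<open>wt x m\<close> decides which of them owns the coefficient at \<open>m\<close>.
    Subtracting \<open>t m\<close> in the bracket leaves only smaller degrees.\<close>
  define \<Phi> where "\<Phi> t m = (if m = {#} then 0 else g m - (mul w (A t) (mul w (B t) (C t)) m - t m))" for t m
  have "\<Phi> t m = \<Phi> t' m" if ag: "agree (size m) t t'" for t t' m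
  proof (cases "m = {#}")
    case True
    then show ?thesis by (simp add: \<Phi>_def)
  next
    case False
    have ABC: "agree (size m) (A t) (A t')" "agree (size m) (B t) (B t')" "agree (size m) (C t) (C t')"
      using ag by (auto simp: agree_def A_def B_def C_def)
    have "mul w (B t) (C t) m - mul w (B t') (C t') m = (B t m - B t' m) * C t {#} + B t {#} * (C t m - C t' m)"
      by (rule mul_diff) (use ABC False in auto)
    moreover have "mul w (A t) (mul w (B t) (C t)) m - mul w (A t') (mul w (B t') (C t')) m
      = (A t m - A t' m) * mul w (B t) (C t) {#} + A t {#} * (mul w (B t) (C t) m - mul w (B t') (C t') m)"
      by (rule mul_diff) (use ABC False in \<open>auto intro: mul_agree\<close>)
    moreover have "(A t m - A t' m) + (B t m - B t' m) + (C t m - C t' m) = t m - t' m"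
      using False by (simp add: A_def B_def C_def)
    ultimately show ?thesis using False by (simp add: \<Phi>_def A_def B_def C_def)
  qed
  from contraction_fixpoint[of \<Phi>, OF this] obtain t where t: "\<Phi> t = t" by blast
  have "mul w (A t) (mul w (B t) (C t)) m = g m" for m
    using fun_cong[OF t, of m] assms
    by (cases "m = {#}") (simp_all add: \<Phi>_def A_def B_def C_def)
  then have "factors w x g (A t) (B t) (C t)"
    unfolding factors_def by (auto simp: A_def B_def C_def supported_def pset_def nset_def zset_def)
  then show ?thesis by blast
qed

lemma factors_diff:
  assumes "factors w x g a b c" "factors w x g' a' b' c'" "m \<noteq> {#}"
    and "agree (size m) a a'" "agree (size m) b b'" "agree (size m) c c'"
  shows "(a m - a' m) + (b m - b' m) + (c m - c' m) = g m - g' m"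
proof -
  have "mul w b c m - mul w b' c' m = (b m - b' m) * c {#} + b {#} * (c m - c' m)"
    by (rule mul_diff) (use assms in auto)
  moreover have "mul w a (mul w b c) m - mul w a' (mul w b' c') m
      = (a m - a' m) * mul w b c {#} + a {#} * (mul w b c m - mul w b' c' m)"
    by (rule mul_diff) (use assms in \<open>auto intro: mul_agree\<close>)
  ultimately show ?thesis using assms(1,2) by (simp add: factors_def)
qed

text \<open>To leading order a product of three series is their sum, and the sign of
  \<open>wt x m\<close> leaves at most one summand. The factors are thus determined degree by
  degree; this contains uniqueness.\<close>

lemma factors_agree:
  assumes "factors w x g a b c" "factors w x g' a' b' c'" "agree d g g'"
  shows "agree d a a' \<and> agree d b b' \<and> agree d c c'"
proof -
  have "size m < d \<longrightarrow> a m = a' m \<and> b m = b' m \<and> c m = c' m" for m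
  proof (induction "size m" arbitrary: m rule: less_induct)
    case less
    show ?case
    proof
      assume m: "size m < d"
      show "a m = a' m \<and> b m = b' m \<and> c m = c' m"
      proof (cases "m = {#}")
        case True
        then show ?thesis using assms by (simp add: factors_def)
      next
        case False
        have "(a m - a' m) + (b m - b' m) + (c m - c' m) = g m - g' m"
          by (rule factors_diff[OF assms(1,2) False]) (use less m in \<open>auto simp: agree_def\<close>)
        then have "(a m - a' m) + (b m - b' m) + (c m - c' m) = 0"
          using assms(3) m by (simp add: agree_def)
        then show ?thesis
          using factors_sign[OF assms(1) False] factors_sign[OF assms(2) False]
          by (cases "wt x m" "0::int" rule: linorder_cases) simp_all
      qed
    qed
  qed
  then show ?thesis by (auto simp: agree_def)
qed

text \<open>A degree outside \<open>S\<close> is indecomposable for everything known so far, so the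
  three coefficients there add up to 0, and at most one of them can be nonzero.\<close>

lemma factors_supported:
  assumes "factors w x g a b c" "supported g S" "submonoid S"
  shows "supported a S \<and> supported b S \<and> supported c S"
proof -
  have "m \<notin> S \<longrightarrow> a m = 0 \<and> b m = 0 \<and> c m = 0" for m
  proof (induction "size m" arbitrary: m rule: less_induct)
    case less
    show ?case
    proof
      assume m: "m \<notin> S"
      let ?T = "S \<union> {l. size m \<le> size l}"
      have ne: "m \<noteq> {#}" using m assms(3) by (auto simp: submonoid_def)
      have T: "supported a ?T" "supported b ?T" "supported c ?T" using less by (auto simp: supported_def)
      have sT: "submonoid ?T" using assms(3) by (rule submonoid_cut)
      have "mul w b c m = b m * c {#} + b {#} * c m"
        by (rule mul_indec[OF ne T(2,3)]) (rule indec_cut[OF m assms(3)])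
      moreover have "mul w a (mul w b c) m = a m * mul w b c {#} + a {#} * mul w b c m"
        by (rule mul_indec[OF ne T(1) supported_mul_submonoid[OF T(2,3) sT]]) (rule indec_cut[OF m assms(3)])
      ultimately have "a m + b m + c m = 0"
        using assms m by (simp add: factors_def supported_def)
      then show "a m = 0 \<and> b m = 0 \<and> c m = 0"
        using factors_sign[OF assms(1) ne]
        by (cases "wt x m" "0::int" rule: linorder_cases) simp_all
    qed
  qed
  then show ?thesis by (auto simp: supported_def)
qed

subsection \<open>Logarithmic derivatives\<close>

definition der :: "('i \<Rightarrow> int) \<Rightarrow> 'i ser \<Rightarrow> 'i ser" where
  "der D f m = real_of_int (wt D m) * f m"

text \<open>\<^term>\<open>ell w D n u\<close> stands for the degree-\<^term>\<open>n\<close> part of $\log u$, scaled by $D(n)$, without using logarithms.\<close>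

definition ell :: "('i \<Rightarrow> 'i \<Rightarrow> int) \<Rightarrow> ('i \<Rightarrow> int) \<Rightarrow> 'i multiset \<Rightarrow> 'i ser \<Rightarrow> real" where
  "ell w D n u = mul w (winv w u) (der D u) n"

lemma supported_der: "supported f S \<Longrightarrow> supported (der D f) S"
  by (simp add: supported_def der_def)

lemma der_mul: "der D (mul w f g) = (\<lambda>m. mul w (der D f) g m + mul w f (der D g) m)"
proof
  fix m
  show "der D (mul w f g) m = mul w (der D f) g m + mul w f (der D g) m"
    unfolding mul_eq der_def sum_distrib_left sum.distrib[symmetric]
  proof (intro sum.cong refl)
    fix p assume "p \<in> splits m"
    then have "m = fst p + snd p" by (cases p) auto
    then show "real_of_int (wt D m) * (2 powi pair w (fst p) (snd p) * (f (fst p) * g (snd p))) =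
      2 powi pair w (fst p) (snd p) * (real_of_int (wt D (fst p)) * f (fst p) * g (snd p)) +
      2 powi pair w (fst p) (snd p) * (f (fst p) * (real_of_int (wt D (snd p)) * g (snd p)))"
      by (simp add: algebra_simps)
  qed
qed

text \<open>On the series supported in the kernel of the functional \<^term>\<open>pair w n\<close>, the coefficient at \<^term>\<open>n\<close> is a trace:
  if $n = a + b$ there, then the monomials of degrees $a$ and $b$ commute.\<close>

lemma trace:
  assumes "skew w" "supported f (zset (col w n))" "supported g (zset (col w n))"
  shows "mul w f g n = mul w g f n"
  unfolding mul_eq
proof (rule sum.reindex_bij_witness[of _ prod.swap prod.swap])
  fix p assume p: "p \<in> splits n"
  then have n: "n = fst p + snd p" by (cases p) auto
  have *: "pair w (snd p) (fst p) = pair w (fst p) (snd p)" if "pair w n (fst p) = 0"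
    using that pair_skew[OF assms(1), of "fst p" "fst p"] pair_skew[OF assms(1), of "snd p" "fst p"]
    by (simp add: n)
  show "2 powi pair w (fst (prod.swap p)) (snd (prod.swap p)) * (g (fst (prod.swap p)) * f (snd (prod.swap p))) =
      2 powi pair w (fst p) (snd p) * (f (fst p) * g (snd p))"
  proof (cases "pair w n (fst p) = 0")
    case True
    then show ?thesis by (simp add: *)
  next
    case False
    then show ?thesis using assms(2) by (simp add: supported_def zset_def pair_def)
  qed
qed (auto simp: add.commute)

text \<open>The product rule gives v^{-1} (u^{-1} Du) v + v^{-1} Dv, and cyclicity of the trace
  removes the conjugation.\<close>

lemma ell_mul:
  assumes "skew w" "u {#} = 1" "v {#} = 1" "supported u (zset (col w n))" "supported v (zset (col w n))"
  shows "ell w D n (mul w u v) = ell w D n u + ell w D n v"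
proof -
  let ?i = "winv w"
  have s: "supported (mul w (mul w (?i u) (der D u)) v) (zset (col w n))" "supported (?i v) (zset (col w n))"
    by (intro supported_mul_submonoid supported_winv supported_der assms submonoid_sets)+
  have "ell w D n (mul w u v) = mul w (?i v) (mul w (?i u) (\<lambda>m. mul w (der D u) v m + mul w u (der D v) m)) n"
    using assms(2,3) by (simp add: ell_def winv_mul der_mul mul_assoc)
  also have "\<dots> = mul w (?i v) (mul w (mul w (?i u) (der D u)) v) n + ell w D n v"
    using assms(2) by (simp add: mul_add_right mul_assoc ell_def)
  also have "mul w (?i v) (mul w (mul w (?i u) (der D u)) v) n = mul w (mul w (mul w (?i u) (der D u)) v) (?i v) n"
    by (rule trace[OF assms(1) s(2,1)])
  also have "\<dots> = ell w D n u"
    using assms(3) by (simp add: mul_assoc winv ell_def)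
  finally show ?thesis .
qed

lemma ell_opp:
  assumes "skew w" "u {#} = 1" "supported u (zset (col w n))"
  shows "ell (\<lambda>i j. - w i j) D n u = ell w D n u"
  using assms
  by (simp add: ell_def mul_opp winv_opp trace[OF assms(1) supported_der[OF assms(3)] supported_winv[OF assms(3) submonoid_sets(2) assms(2)]])

text \<open>The Maurer--Cartan equation $[f, g] = D' f - D g$ for $f = u^{-1} D u$ and $g = u^{-1} D' u$, read under the trace.\<close>

lemma ell_change:
  assumes "skew w" "u {#} = 1" "supported u (zset (col w n))"
  shows "wt D n * ell w D' n u = wt D' n * ell w D n u"
proof -
  define f where "f = mul w (winv w u) (der D u)"
  define g where "g = mul w (winv w u) (der D' u)"
  have u: "der D u = mul w u f" "der D' u = mul w u g"
    using assms(2) by (simp_all add: f_def g_def)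
  have s: "supported f (zset (col w n))" "supported g (zset (col w n))"
    unfolding f_def g_def by (intro supported_mul_submonoid supported_winv supported_der assms submonoid_sets)+
  have "der D (der D' u) = der D' (der D u)" by (simp add: der_def fun_eq_iff)
  then have "(\<lambda>m. mul w (mul w u f) g m + mul w u (der D g) m) = (\<lambda>m. mul w (mul w u g) f m + mul w u (der D' f) m)"
    by (simp add: u der_mul)
  then have "mul w u (\<lambda>m. mul w f g m + der D g m) = mul w u (\<lambda>m. mul w g f m + der D' f m)"
    by (simp add: mul_add_right mul_assoc)
  then have "(\<lambda>m. mul w f g m + der D g m) = (\<lambda>m. mul w g f m + der D' f m)"
    by (metis winv_left assms(2))
  from fun_cong[OF this, of n] have "der D g n = der D' f n"
    using trace[OF assms(1) s] by simp
  then show ?thesis by (simp add: der_def f_def g_def ell_def)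
qed

lemma ell_zero:
  assumes "u {#} = 1" "supported u S" "submonoid S" "n \<notin> S"
  shows "ell w D n u = 0"
proof -
  have "supported (mul w (winv w u) (der D u)) S"
    by (intro supported_mul_submonoid supported_winv supported_der assms)
  then show ?thesis using assms(4) by (simp add: ell_def supported_def)
qed

lemma ell_indec:
  fixes u :: "'i ser"
  assumes "u {#} = 1" "supported u S" "submonoid S" "n \<noteq> {#}"
    and "\<And>a b. a \<in> S \<Longrightarrow> b \<in> S \<Longrightarrow> a + b = n \<Longrightarrow> a = {#} \<or> b = {#}"
  shows "ell w D n u = wt D n * u n"
proof -
  have "ell w D n u = winv w u n * der D u {#} + winv w u {#} * der D u n"
    unfolding ell_def
    by (rule mul_indec[OF assms(4) supported_winv[OF assms(2,3,1)] supported_der[OF assms(2)] assms(5)])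
  then show ?thesis using assms(1) by (simp add: der_def winv)
qed

lemma ell_diff:
  fixes u u' :: "'i ser"
  assumes "u {#} = 1" "u' {#} = 1" "n \<noteq> {#}" "agree (size n) u u'"
  shows "ell w D n u - ell w D n u' = wt D n * (u n - u' n)"
proof -
  have "ell w D n u - ell w D n u' = (winv w u n - winv w u' n) * der D u {#} + winv w u {#} * (der D u n - der D u' n)"
    unfolding ell_def
    by (rule mul_diff[OF winv_agree[OF assms(4,1,2)] _ assms(3)]) (use assms(4) in \<open>simp add: agree_def der_def\<close>)
  then show ?thesis using assms by (simp add: der_def winv algebra_simps)
qed

subsection \<open>The quantum dilogarithm\<close>

text \<open>Coefficients of the series \<psi> with \<psi>(0) = 1 and \<psi>(X/q^2) = (1 + X/q)
  \<psi>(X); the recursion compares the coefficients of X^{j+1}.\<close>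

fun dil :: "real \<Rightarrow> nat \<Rightarrow> real" where
  "dil q 0 = 1"
| "dil q (Suc j) = dil q j * ((1 / q) / (1 / q ^ (2 * Suc j) - 1))"

definition dil_fps :: "real \<Rightarrow> real \<Rightarrow> real fps" where
  "dil_fps q c = Abs_fps (\<lambda>j. dil q j * c ^ j)"

lemma dil_fps_shift:
  assumes "q > 1"
  shows "dil_fps q (c / q^2) = (1 + fps_const (c / q) * fps_X) * dil_fps q c"
proof (rule fps_ext)
  fix n
  show "fps_nth (dil_fps q (c / q^2)) n = fps_nth ((1 + fps_const (c / q) * fps_X) * dil_fps q c) n"
  proof (cases n)
    case 0
    then show ?thesis by (simp add: dil_fps_def)
  next
    case (Suc j)
    have "q ^ (2 * Suc j) > 1" using assms by (intro one_less_power) auto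
    then have ne: "1 / q ^ (2 * Suc j) - 1 \<noteq> 0" by (simp add: field_simps)
    have rec: "dil q (Suc j) * (1 / q ^ (2 * Suc j) - 1) = dil q j / q"
      using ne unfolding dil.simps(2) by (metis nonzero_eq_divide_eq times_divide_eq_right mult.right_neutral)
    have "dil q (Suc j) * (c / q^2) ^ Suc j - dil q (Suc j) * c ^ Suc j
      = dil q (Suc j) * (1 / q ^ (2 * Suc j) - 1) * c ^ Suc j"
      unfolding power_divide power_mult[symmetric] by (simp add: algebra_simps del: dil.simps power_Suc)
    also have "\<dots> = (c / q) * (dil q j * c ^ j)" unfolding rec by simp
    finally show ?thesis
      by (simp add: Suc dil_fps_def algebra_simps fps_mult_left_const_nth mult.assoc del: dil.simps power_Suc)
  qed
qed

text \<open>In closed form, \<^term>\<open>gauss_fps q r\<close> is $\prod_{j<r} (1 + q^{r-1-2j} X)$; pairing the factors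
  $j$ and $r-1-j$ makes its palindromicity visible.\<close>

fun gauss_fps :: "real \<Rightarrow> nat \<Rightarrow> real fps" where
  "gauss_fps q 0 = 1"
| "gauss_fps q (Suc 0) = 1 + fps_X"
| "gauss_fps q (Suc (Suc r)) = (1 + fps_const (1 / q ^ Suc r) * fps_X) * ((1 + fps_const (q ^ Suc r) * fps_X) * gauss_fps q r)"

text \<open>The functional equation telescopes between q^r and 1/q^r. The induction goes in steps of
  two because one application is made at each end.\<close>

lemma dil_fps_gauss_fps:
  assumes "q > 1"
  shows "dil_fps q (1 / q ^ r) = gauss_fps q r * dil_fps q (q ^ r)"
  using assms
proof (induction q r rule: gauss_fps.induct)
  case (2 q)
  then show ?case using dil_fps_shift[of q q] by (simp add: power2_eq_square)
next
  case (3 q r)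
  have "dil_fps q (1 / q ^ Suc (Suc r)) = (1 + fps_const (1 / q ^ Suc r) * fps_X) * dil_fps q (1 / q ^ r)"
    using dil_fps_shift[OF 3(2), of "1 / q ^ r"] by (simp add: power2_eq_square mult_ac)
  moreover have "dil_fps q (q ^ r) = (1 + fps_const (q ^ Suc r) * fps_X) * dil_fps q (q ^ Suc (Suc r))"
    using dil_fps_shift[OF 3(2), of "q ^ Suc (Suc r)"] 3(2) by (simp add: power2_eq_square)
  ultimately show ?case using 3 by (simp add: mult_ac)
qed simp

lemma dil_fps_nonzero: "dil_fps q c \<noteq> 0"
proof
  assume "dil_fps q c = 0"
  then have "fps_nth (dil_fps q c) 0 = 0" by simp
  then show False by (simp add: dil_fps_def)
qed

section \<open>Reversal of polynomials\<close>

definition deg_le :: "real fps \<Rightarrow> nat \<Rightarrow> bool" where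
  "deg_le F N \<longleftrightarrow> (\<forall>i>N. fps_nth F i = 0)"

definition rev_fps :: "nat \<Rightarrow> real fps \<Rightarrow> real fps" where
  "rev_fps N F = Abs_fps (\<lambda>i. if i \<le> N then fps_nth F (N - i) else 0)"

lemma quad_nth:
  fixes F :: "real fps"
  shows
  "fps_nth ((1 + fps_const a * fps_X) * ((1 + fps_const b * fps_X) * F)) i =
    fps_nth F i + (if i \<ge> 1 then (a + b) * fps_nth F (i - 1) else 0) + (if i \<ge> 2 then a * b * fps_nth F (i - 2) else 0)"
proof -
  have "(1 + fps_const a * fps_X) * ((1 + fps_const b * fps_X) * F)
    = F + fps_const (a + b) * (fps_X * F) + fps_const (a * b) * (fps_X * (fps_X * F))"
    unfolding fps_const_add[symmetric] fps_const_mult[symmetric] by (simp add: algebra_simps del: fps_const_add fps_const_mult)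
  then show ?thesis by (simp add: numeral_2_eq_2)
qed

lemma gauss_fps_deg_le: "deg_le F N \<Longrightarrow> deg_le (gauss_fps q r * F) (N + r)"
proof (induction q r rule: gauss_fps.induct)
  case (2 q)
  then show ?case by (auto simp: deg_le_def distrib_right)
next
  case (3 q r)
  then have "deg_le (gauss_fps q r * F) (N + r)" by simp
  then show ?case
    unfolding deg_le_def gauss_fps.simps mult.assoc quad_nth by auto
qed simp

text \<open>Factors pair up as (1 + aX)(1 + bX) with ab = 1, that is 1 + (a+b)X + X^2, which equals
  its reversal; so does a single 1 + X. Reversal is relative to the bound \<open>N\<close>, which
  may exceed the true degree.\<close>

lemma gauss_fps_rev:
  assumes "q > 1" "deg_le F N"
  shows "rev_fps (N + r) (gauss_fps q r * F) = gauss_fps q r * rev_fps N F"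
  using assms
proof (induction q r rule: gauss_fps.induct)
  case (2 q)
  show ?case
  proof (rule fps_ext)
    fix i
    show "fps_nth (rev_fps (N + Suc 0) (gauss_fps q (Suc 0) * F)) i = fps_nth (gauss_fps q (Suc 0) * rev_fps N F) i"
      using 2(2) by (cases i) (auto simp: rev_fps_def deg_le_def distrib_right Suc_diff_le le_Suc_eq)
  qed
next
  case (3 q r)
  let ?G = "gauss_fps q r * F"
  have IH: "rev_fps (N + r) ?G = gauss_fps q r * rev_fps N F" and dG: "deg_le ?G (N + r)"
    using 3 gauss_fps_deg_le by auto
  have ab: "1 / q ^ Suc r * q ^ Suc r = 1" using 3(2) by simp
  have "fps_nth (rev_fps (M + 2) ((1 + fps_const a * fps_X) * ((1 + fps_const b * fps_X) * G))) i =
    fps_nth ((1 + fps_const a * fps_X) * ((1 + fps_const b * fps_X) * rev_fps M G)) i"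
    if "deg_le G M" "a * b = 1" for G M a b i
  proof -
    consider "i = 0" | "i = 1" | "2 \<le> i" "i \<le> M" | "2 \<le> i" "i = M + 1" | "2 \<le> i" "i = M + 2" | "i > M + 2" by linarith
    then show ?thesis
    proof cases
      case 3
      then have "M + 2 - i - 1 = M - (i - 1)" "M + 2 - i - 2 = M - i" "M + 2 - i = M - (i - 2)" by auto
      then show ?thesis using that 3 unfolding quad_nth rev_fps_def fps_nth_Abs_fps by auto
    qed (use that in \<open>auto simp: quad_nth rev_fps_def deg_le_def algebra_simps\<close>)
  qed
  from this[OF dG ab] show ?case
    by (intro fps_ext) (simp add: IH mult.assoc)
qed (simp add: rev_fps_def)

section \<open>The dilogarithm of one variable inside the quantum torus\<close>

definition dil_series :: "real \<Rightarrow> 'i \<Rightarrow> 'i ser" where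
  "dil_series q k m = (if m = replicate_mset (count m k) k then dil q (count m k) else 0)"

definition multiples :: "'i \<Rightarrow> 'i multiset set" where
  "multiples k = range (\<lambda>a. replicate_mset a k)"

lemma in_multiples: "m \<in> multiples k \<longleftrightarrow> m = replicate_mset (count m k) k"
  by (auto simp: multiples_def)

lemma replicate_mset_add: "replicate_mset (i + j) k = replicate_mset i k + replicate_mset j k"
  by (rule multiset_eqI) simp

lemma submonoid_multiples: "submonoid (multiples k)"
  unfolding submonoid_def
proof (intro conjI ballI)
  show "{#} \<in> multiples k" by (simp add: in_multiples)
  fix a b assume "a \<in> multiples k" "b \<in> multiples k"
  then obtain i j where "a = replicate_mset i k" "b = replicate_mset j k" by (auto simp: multiples_def)
  then have "a + b = replicate_mset (i + j) k" by (simp add: replicate_mset_add)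
  then show "a + b \<in> multiples k" by (simp add: multiples_def)
qed

lemma dil_series_simps [simp]: "dil_series q k {#} = 1" "dil_series q k (replicate_mset a k) = dil q a"
  by (simp_all add: dil_series_def)

lemma supported_dil_series: "supported (dil_series q k) (multiples k)"
  by (auto simp: supported_def dil_series_def in_multiples)

definition slice :: "'i \<Rightarrow> 'i ser \<Rightarrow> 'i multiset \<Rightarrow> real fps" where
  "slice k f n = Abs_fps (\<lambda>a. f (n + replicate_mset a k))"

text \<open>Moving X_k^i past degree n costs the factor q^{i \<beta>}, and powers of X_k commute
  among themselves. On slices the twisted product thus becomes an ordinary product of power series
  with rescaled argument.\<close>

lemma slice_mul_left:
  assumes "skew w" "k \<notin># n" "wt (w k) n = d * \<beta>" "q = 2 powi d"
  shows "slice k (mul w (dil_series q k) f) n = dil_fps q (q powi \<beta>) * slice k f n"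
proof (rule fps_ext)
  fix a
  let ?m = "n + replicate_mset a k"
  let ?I = "\<lambda>i. (replicate_mset i k, n + replicate_mset (a - i) k)"
  have wkk: "w k k = 0" using assms(1) unfolding skew_def by (metis equal_neg_zero)
  have inj: "inj_on ?I {0..a}" by (auto simp: inj_on_def replicate_mset_eq_iff)
  have "mul w (dil_series q k) f ?m = (\<Sum>(u, v)\<in>?I ` {0..a}. 2 powi pair w u v * (dil_series q k u * f v))"
    unfolding mul_def
  proof (rule sum.mono_neutral_right)
    show "?I ` {0..a} \<subseteq> splits ?m"
      by (auto intro!: multiset_eqI)
    show "\<forall>p\<in>splits ?m - ?I ` {0..a}. (case p of (u, v) \<Rightarrow> 2 powi pair w u v * (dil_series q k u * f v)) = 0"
    proof
      fix p assume p: "p \<in> splits ?m - ?I ` {0..a}"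
      obtain u v where uv: "p = (u, v)" by (cases p)
      then have s: "u + v = ?m" using p by simp
      have "u \<noteq> replicate_mset (count u k) k"
      proof
        assume u: "u = replicate_mset (count u k) k"
        have "count u k \<le> count ?m k" unfolding s[symmetric] by simp
        then have le: "count u k \<le> a" using assms(2) by (simp add: not_in_iff)
        have "v = ?m - u" using s by (metis add_diff_cancel_left')
        also have "?m = n + replicate_mset (a - count u k) k + replicate_mset (count u k) k"
          using le by (simp add: union_assoc replicate_mset_add[symmetric])
        also have "\<dots> - u = n + replicate_mset (a - count u k) k"
          using u by (metis add_diff_cancel_right')
        finally show False using p uv u le by (auto simp: image_iff)
      qed
      then show "(case p of (u, v) \<Rightarrow> 2 powi pair w u v * (dil_series q k u * f v)) = 0"
        by (simp add: uv dil_series_def)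
    qed
  qed simp
  also have "\<dots> = (\<Sum>i=0..a. 2 powi (int i * (d * \<beta>)) * (dil q i * f (n + replicate_mset (a - i) k)))"
  proof (subst sum.reindex[OF inj], intro sum.cong refl)
    fix i
    have "col w (replicate_mset i k) = (\<lambda>j. int i * w k j)"
      by (simp add: col_def fun_eq_iff)
    then have "pair w (replicate_mset i k) (n + replicate_mset (a - i) k) = int i * (d * \<beta>)"
      using assms(3) wkk by (simp add: pair_def wt_fun(3))
    then show "((\<lambda>(u, v). 2 powi pair w u v * (dil_series q k u * f v)) \<circ> ?I) i
      = 2 powi (int i * (d * \<beta>)) * (dil q i * f (n + replicate_mset (a - i) k))" by simp
  qed
  also have "\<dots> = (\<Sum>i=0..a. (dil q i * (q powi \<beta>) ^ i) * f (n + replicate_mset (a - i) k))"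
  proof (intro sum.cong refl)
    fix i
    have "(2::real) powi (int i * (d * \<beta>)) = (q powi \<beta>) ^ i"
      using assms(4) by (metis mult.commute power_int_mult power_int_of_nat)
    then show "2 powi (int i * (d * \<beta>)) * (dil q i * f (n + replicate_mset (a - i) k))
      = (dil q i * (q powi \<beta>) ^ i) * f (n + replicate_mset (a - i) k)" by simp
  qed
  finally show "fps_nth (slice k (mul w (dil_series q k) f) n) a = fps_nth (dil_fps q (q powi \<beta>) * slice k f n) a"
    by (simp add: slice_def dil_fps_def fps_mult_nth)
qed

lemma slice_mul_right:
  assumes "skew w" "k \<notin># n" "wt (w k) n = d * \<beta>" "q = 2 powi d"
  shows "slice k (mul w f (dil_series q k)) n = dil_fps q (q powi (- \<beta>)) * slice k f n"
  using slice_mul_left[OF skew_uminus[OF assms(1)] assms(2) _ assms(4), of "- \<beta>" f] assms(3)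
  by (simp add: mul_opp[OF assms(1)] wt_fun)

lemma decomp: "m = filter_mset (\<lambda>j. j \<noteq> k) m + replicate_mset (count m k) k"
  by (rule multiset_eqI) simp

lemma slice_eqI:
  assumes "\<And>n. k \<notin># n \<Longrightarrow> slice k f n = slice k g n"
  shows "f = g"
proof
  fix m
  have "fps_nth (slice k f (filter_mset (\<lambda>j. j \<noteq> k) m)) (count m k) = fps_nth (slice k g (filter_mset (\<lambda>j. j \<noteq> k) m)) (count m k)"
    by (subst assms) simp_all
  then show "f m = g m" by (simp add: slice_def decomp[symmetric])
qed

subsection \<open>Attaching a factor\<close>

text \<open>Multiplying by series of x-degree 0 preserves x-degrees. The constant term of
  \<open>a\<close> contributes \<open>mul w u v = one\<close>, so only its strictly positive part
  has to be followed.\<close>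

lemma conj_pset:
  assumes "supported a (pset x)" "a {#} = 1" "supported u (zset x)" "supported v (zset x)" "mul w u v = one"
  shows "supported (mul w u (mul w a v)) (pset x)"
proof -
  define a0 where "a0 m = a m - one m" for m
  have a: "a = (\<lambda>m. one m + a0 m)" by (simp add: a0_def)
  have s: "supported a0 {m. wt x m > 0}"
    using assms(1,2) by (auto simp: supported_def pset_def a0_def one_def)
  have s1: "supported (mul w a0 v) {m. wt x m > 0}"
    by (rule supported_mul[OF s assms(4)]) (auto simp: zset_def)
  have "supported (mul w u (mul w a0 v)) {m. wt x m > 0}"
    by (rule supported_mul[OF assms(3) s1]) (auto simp: zset_def)
  moreover have "mul w u (mul w a v) = (\<lambda>m. one m + mul w u (mul w a0 v) m)"
    unfolding a by (simp add: mul_add_left mul_add_right assms(5))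
  ultimately show ?thesis by (auto simp: supported_def pset_def one_def)
qed

text \<open>If \<omega>(n,e_k) > 0, then \<open>u\<close> is absorbed by the positive factor. If it
  is 0, then u a b c = (u a u^{-1}) (u b) c, and \<open>u b\<close> has the same \<open>ell\<close>
  as \<open>b\<close> because \<open>n\<close> is no multiple of \<open>e_k\<close>.\<close>

lemma factors_attach_left:
  assumes "skew w" "factors w (col w n) h a b c" "\<And>D. ell w D n b = 0"
    and "supported u (multiples k)" "u {#} = 1" "col w n k \<ge> 0" "n \<notin> multiples k"
  shows "\<exists>a b c. factors w (col w n) (mul w u h) a b c \<and> (\<forall>D. ell w D n b = 0)"
proof (cases "col w n k = 0")
  case True
  let ?x = "col w n"
  have u: "supported u (zset ?x)" using assms(4) True by (rule_tac supported_mono) (auto simp: multiples_def zset_def)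
  have i: "supported (winv w u) (zset ?x)" by (rule supported_winv[OF u submonoid_sets(2) assms(5)])
  let ?a = "mul w u (mul w a (winv w u))" and ?b = "mul w u b"
  have "factors w ?x (mul w u h) ?a ?b c"
    using assms(2,5) u i unfolding factors_def
    using conj_pset[OF _ _ u i winv(1)[of u w, OF assms(5)], of a] supported_mul_submonoid[OF u _ submonoid_sets(2), of b]
    by (auto simp: winv mul_assoc)
  moreover have "ell w D n ?b = 0" for D
    using ell_mul[OF assms(1,5) _ u, of b D] assms(2,3) ell_zero[OF assms(5,4) submonoid_multiples assms(7)]
    by (simp add: factors_def)
  ultimately show ?thesis by blast
next
  case False
  let ?x = "col w n"
  have "supported u (pset ?x)"
    using assms(4)
  proof (rule supported_mono)
    show "multiples k \<subseteq> pset ?x"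
    proof
      fix m assume "m \<in> multiples k"
      then obtain i where "m = replicate_mset i k" by (auto simp: multiples_def)
      then show "m \<in> pset ?x" using False assms(6) by (cases "i = 0") (auto simp: pset_def)
    qed
  qed
  then have "factors w ?x (mul w u h) (mul w u a) b c"
    using assms(2,5) unfolding factors_def by (auto simp: mul_assoc intro!: supported_mul_submonoid submonoid_sets)
  then show ?thesis using assms(3) by blast
qed

lemma factors_opp_ell:
  assumes "skew w" "factors w (col w n) h a b c" "\<And>D. ell w D n b = 0"
  shows "factors (\<lambda>i j. - w i j) (col (\<lambda>i j. - w i j) n) h c b a \<and> (\<forall>D. ell (\<lambda>i j. - w i j) D n b = 0)"
  using factors_opp[OF assms(1,2)] ell_opp[OF assms(1), of b n] assms(2,3)
  by (auto simp: col_uminus factors_def)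

lemma factors_attach_right:
  assumes "skew w" "factors w (col w n) h a b c" "\<And>D. ell w D n b = 0"
    and "supported u (multiples k)" "u {#} = 1" "col w n k \<le> 0" "n \<notin> multiples k"
  shows "\<exists>a b c. factors w (col w n) (mul w h u) a b c \<and> (\<forall>D. ell w D n b = 0)"
proof -
  let ?w = "\<lambda>i j. - w i j"
  have "factors ?w (col ?w n) h c b a" "\<And>D. ell ?w D n b = 0"
    using factors_opp_ell[OF assms(1-3)] by auto
  moreover have "col ?w n k \<ge> 0" using assms(6) by (simp add: col_uminus)
  ultimately obtain a' b' c' where "factors ?w (col ?w n) (mul ?w u h) a' b' c'" "\<And>D. ell ?w D n b' = 0"
    using factors_attach_left[OF skew_uminus[OF assms(1)]] assms(4,5,7) by blast
  from factors_opp_ell[OF skew_uminus[OF assms(1)] this]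
  show ?thesis by (auto simp: mul_opp[OF assms(1)])
qed

subsection \<open>Seeds\<close>

definition symm_form :: "('i \<Rightarrow> int) \<Rightarrow> ('i \<Rightarrow> 'i \<Rightarrow> int) \<Rightarrow> 'i \<Rightarrow> 'i \<Rightarrow> int" where
  "symm_form \<delta> b i j = \<delta> i * b i j"

definition axis :: "'i multiset \<Rightarrow> bool" where
  "axis m \<longleftrightarrow> (\<exists>i. m \<in> multiples i)"

text \<open>\<^const>\<open>factors\<close> at \<^term>\<open>col (symm_form \<delta> b) n\<close> with vanishing \<^const>\<open>ell\<close> says that the only incoming walls are the
  coordinate hyperplanes, carrying quantum dilogarithms.\<close>

definition good :: "('i \<Rightarrow> int) \<Rightarrow> ('i \<Rightarrow> 'i \<Rightarrow> int) \<Rightarrow> 'i ser \<Rightarrow> bool" where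
  "good \<delta> b g \<longleftrightarrow> (\<forall>i a. g (replicate_mset a i) = dil (2 powi \<delta> i) a) \<and>
     (\<forall>n. \<not> axis n \<longrightarrow> (\<exists>u v u'. factors (symm_form \<delta> b) (col (symm_form \<delta> b) n) g u v u' \<and> (\<forall>D. ell (symm_form \<delta> b) D n v = 0)))"

definition wall_free :: "('i \<Rightarrow> 'i \<Rightarrow> int) \<Rightarrow> ('i \<Rightarrow> int) \<Rightarrow> 'i ser \<Rightarrow> bool" where
  "wall_free w x g \<longleftrightarrow> (\<exists>a c. factors w x g a one c)"

definition mut_b :: "'i \<Rightarrow> ('i \<Rightarrow> 'i \<Rightarrow> int) \<Rightarrow> 'i \<Rightarrow> 'i \<Rightarrow> int" where
  "mut_b k b i j = (if i = k \<or> j = k then - b i j else b i j + (max (- b i k) 0 * b k j + b i k * max (b k j) 0))"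

definition trop_up :: "('i \<Rightarrow> 'i \<Rightarrow> int) \<Rightarrow> 'i \<Rightarrow> ('i \<Rightarrow> int) \<Rightarrow> 'i \<Rightarrow> int" where
  "trop_up b k x i = (if i = k then - x k else x i + max (b k i) 0 * x k)"

definition bplus :: "('i \<Rightarrow> 'i \<Rightarrow> int) \<Rightarrow> 'i \<Rightarrow> 'i \<Rightarrow> int" where
  "bplus b k j = max (b k j) 0"

text \<open>The degrees whose reflected exponent of \<open>X_k\<close> is still nonnegative. The
  same inequality turns out to bound the left quotient of a good series by its dilogarithm.\<close>

definition slab :: "('i \<Rightarrow> 'i \<Rightarrow> int) \<Rightarrow> 'i \<Rightarrow> 'i multiset set" where
  "slab b k = {m. int (count m k) \<le> wt (bplus b k) m}"

text \<open>The change of degrees dual to \<^const>\<open>trop_up\<close>; it is additive and involutive on \<^const>\<open>slab\<close> only, where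
  the subtraction on \<^typ>\<open>nat\<close> is not truncated.\<close>

definition reflect :: "('i \<Rightarrow> 'i \<Rightarrow> int) \<Rightarrow> 'i \<Rightarrow> 'i multiset \<Rightarrow> 'i multiset" where
  "reflect b k m = filter_mset (\<lambda>j. j \<noteq> k) m + replicate_mset (nat (wt (bplus b k) m) - count m k) k"

definition push :: "('i \<Rightarrow> 'i \<Rightarrow> int) \<Rightarrow> 'i \<Rightarrow> 'i ser \<Rightarrow> 'i ser" where
  "push b k f m = (if m \<in> slab b k then f (reflect b k m) else 0)"

text \<open>Total degree in the variables other than \<open>X_k\<close>. It vanishes exactly on the
  multiples of \<open>e_k\<close> and is invariant under \<open>reflect\<close>, so it serves both
  as induction measure and as the derivation that survives mutation.\<close>

definition codeg :: "'i \<Rightarrow> 'i \<Rightarrow> int" where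
  "codeg k i = (if i = k then 0 else 1)"

definition lquot :: "('i \<Rightarrow> 'i \<Rightarrow> int) \<Rightarrow> 'i ser \<Rightarrow> 'i ser \<Rightarrow> 'i ser" where "lquot w e g = mul w (winv w e) g"
definition rquot :: "('i \<Rightarrow> 'i \<Rightarrow> int) \<Rightarrow> 'i ser \<Rightarrow> 'i ser \<Rightarrow> 'i ser" where "rquot w e g = mul w g (winv w e)"

lemma symm_form_uminus: "symm_form \<delta> (\<lambda>i j. - b i j) = (\<lambda>i j. - symm_form \<delta> b i j)"
  by (simp add: symm_form_def fun_eq_iff)

lemma mut_b_uminus: "mut_b k (\<lambda>i j. - b i j) = (\<lambda>i j. - mut_b k b i j)"
proof (intro ext)
  fix i j
  have "max x 0 * - y + - x * max (- y) 0 = - (max (- x) 0 * y + x * max y 0)" for x y :: int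
    by (cases "x \<ge> 0"; cases "y \<ge> 0") (simp_all add: max_def)
  from this[of "b i k" "b k j"] show "mut_b k (\<lambda>i j. - b i j) i j = - mut_b k b i j" by (simp add: mut_b_def)
qed

lemma wt_point: "wt (\<lambda>i. if i = k then c else 0) m = int (count m k) * c"
  by (induction m) (simp_all add: algebra_simps)

lemma wt_nonneg: "(\<And>i. x i \<ge> 0) \<Longrightarrow> wt x m \<ge> 0"
  by (induction m) simp_all

lemma codeg_nonneg: "wt (codeg k) m \<ge> 0"
  by (rule wt_nonneg) (simp add: codeg_def)

lemma codeg_zero: "wt (codeg k) m = 0 \<longleftrightarrow> m \<in> multiples k"
proof
  assume "wt (codeg k) m = 0"
  then have "\<forall>i\<in>#m. i = k"
  proof (induction m)
    case (add i m)
    then show ?case using codeg_nonneg[of k m] codeg_def[of k i] by (auto split: if_splits)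
  qed simp
  then show "m \<in> multiples k" by (auto simp: in_multiples intro!: multiset_eqI simp flip: not_in_iff)
next
  assume "m \<in> multiples k"
  then show "wt (codeg k) m = 0" by (auto simp: multiples_def codeg_def)
qed

lemma wt_filter: "wt x (filter_mset (\<lambda>j. j \<noteq> k) m) = wt x m - int (count m k) * x k"
  by (induction m) (auto simp: algebra_simps)

lemma bplus_nonneg: "wt (bplus b k) m \<ge> 0"
  by (rule wt_nonneg) (simp add: bplus_def)

lemma bplus_uminus: "wt (bplus (\<lambda>i j. - b i j) k) m = wt (bplus b k) m - wt (b k) m"
  by (induction m) (auto simp: bplus_def)

lemma submonoid_slab: "submonoid (slab b k)"
  by (auto simp: submonoid_def slab_def)

section \<open>Quotients of a good series by a dilogarithm\<close>

locale seed =
  fixes \<delta> :: "'i \<Rightarrow> int" and b :: "'i \<Rightarrow> 'i \<Rightarrow> int"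
  assumes delta_pos: "\<delta> i > 0"
    and skew_b: "\<delta> i * b i j = - (\<delta> j * b j i)"
begin

abbreviation "w \<equiv> symm_form \<delta> b"
abbreviation "q k \<equiv> 2 powi \<delta> k :: real"
abbreviation "E k \<equiv> dil_series (q k) k"

lemma skew_w: "skew w"
  unfolding skew_def symm_form_def by (intro allI, rule skew_b)

lemma neg: "seed \<delta> (\<lambda>i j. - b i j)"
proof
  show "\<delta> i > 0" for i by (rule delta_pos)
  show "\<delta> i * - b i j = - (\<delta> j * - b j i)" for i j using skew_b[of i j] by simp
qed

lemma bkk [simp]: "b k k = 0"
  using skew_b[of k k] delta_pos[of k] by simp

lemma wt_w: "wt (w k) m = \<delta> k * wt (b k) m"
  unfolding symm_form_def by (rule wt_fun(3))

lemma col_k: "col w m k = - \<delta> k * wt (b k) m"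
proof -
  have "(\<lambda>i. w i k) = (\<lambda>i. - \<delta> k * b k i)"
  proof
    fix i show "w i k = - \<delta> k * b k i" using skew_b[of i k] by (simp add: symm_form_def)
  qed
  then show ?thesis unfolding col_def by (simp only: wt_fun(3))
qed

lemma col_k_sign: "col w m k \<ge> 0 \<longleftrightarrow> wt (b k) m \<le> 0" "col w m k \<le> 0 \<longleftrightarrow> wt (b k) m \<ge> 0"
  using delta_pos[of k] by (simp_all add: col_k mult_le_0_iff zero_le_mult_iff)

lemma q_gt_1: "q k > 1"
proof -
  have "(2::real) powi \<delta> k = 2 ^ nat (\<delta> k)"
    using delta_pos[of k] by (simp add: power_int_def)
  then show ?thesis using delta_pos[of k] by simp
qed

lemma good_empty: "good \<delta> b g \<Longrightarrow> g {#} = 1"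
  unfolding good_def by (metis dil.simps(1) replicate_mset_0)

lemma mul_lquot: "mul w (E k) (lquot w (E k) g) = g"
  by (simp add: lquot_def)

lemma mul_rquot: "mul w (rquot w (E k) g) (E k) = g"
  by (simp add: rquot_def mul_assoc winv)

lemma rquot_neg: "lquot (\<lambda>i j. - w i j) (E k) g = rquot w (E k) g" "rquot (\<lambda>i j. - w i j) (E k) g = lquot w (E k) g"
  by (simp_all add: lquot_def rquot_def winv_opp[OF skew_w] mul_opp[OF skew_w])

lemma good_neg:
  assumes "good \<delta> b g"
  shows "good \<delta> (\<lambda>i j. - b i j) g"
  unfolding good_def symm_form_uminus
proof (intro conjI allI impI)
  show "g (replicate_mset a i) = dil (q i) a" for a i using assms by (simp add: good_def)
  fix n :: "'i multiset" assume "\<not> axis n"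
  then obtain u v u' where "factors w (col w n) g u v u'" "\<And>D. ell w D n v = 0"
    using assms unfolding good_def by blast
  from factors_opp_ell[OF skew_w this]
  show "\<exists>u v u'. factors (\<lambda>i j. - w i j) (col (\<lambda>i j. - w i j) n) g u v u' \<and> (\<forall>D. ell (\<lambda>i j. - w i j) D n v = 0)"
    by blast
qed

text \<open>Both quotients come from the same \<open>g\<close>, so their slices differ by
  \<psi>(X/q^r) / \<psi>(q^r X), the wall-crossing polynomial.\<close>

lemma slice_eq:
  assumes "k \<notin># n" "wt (b k) n = - int r"
  shows "slice k (rquot w (E k) g) n = gauss_fps (q k) r * slice k (lquot w (E k) g) n"
proof -
  have *: "wt (w k) n = \<delta> k * (- int r)" using assms(2) by (simp add: wt_w)
  have "dil_fps (q k) (q k powi (- int r)) * slice k (lquot w (E k) g) n = slice k g n"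
    using slice_mul_left[OF skew_w assms(1) * refl, of "lquot w (E k) g"] by (simp add: mul_lquot)
  moreover have "dil_fps (q k) (q k powi (int r)) * slice k (rquot w (E k) g) n = slice k g n"
    using slice_mul_right[OF skew_w assms(1) * refl, of "rquot w (E k) g"] by (simp add: mul_rquot)
  moreover have "dil_fps (q k) (q k powi (- int r)) = gauss_fps (q k) r * dil_fps (q k) (q k powi int r)"
    using dil_fps_gauss_fps[OF q_gt_1, of k r] by (simp add: power_int_minus divide_inverse)
  ultimately have "dil_fps (q k) (q k powi int r) * slice k (rquot w (E k) g) n
    = dil_fps (q k) (q k powi int r) * (gauss_fps (q k) r * slice k (lquot w (E k) g) n)"
    by (simp add: mult_ac)
  then show ?thesis using dil_fps_nonzero by simp
qed

lemma slice_multiples: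
  assumes "g = mul w (E k) h" "\<And>a. g (replicate_mset a k) = dil (q k) a"
  shows "h (replicate_mset a k) = one (replicate_mset a k)"
proof -
  have "slice k g {#} = dil_fps (q k) 1 * slice k h {#}"
    using slice_mul_left[OF skew_w, of k "{#}" "\<delta> k" 0 "q k" h] by (simp add: assms(1))
  moreover have "slice k g {#} = dil_fps (q k) 1"
    by (rule fps_ext) (simp add: slice_def dil_fps_def assms(2))
  ultimately have "slice k h {#} = 1" using dil_fps_nonzero[of "q k" 1] by simp
  then have "fps_nth (slice k h {#}) a = fps_nth 1 a" by simp
  then show ?thesis by (cases a) (simp_all add: slice_def one_def)
qed

lemma lquot_multiples: "good \<delta> b g \<Longrightarrow> m \<in> multiples k \<Longrightarrow> lquot w (E k) g m = one m"
  using slice_multiples[of g k "lquot w (E k) g"] by (auto simp: mul_lquot good_def multiples_def)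

lemma slab_multiples: "m \<in> slab b k \<Longrightarrow> m \<in> multiples k \<Longrightarrow> m = {#}"
  by (auto simp: slab_def multiples_def bplus_def)

text \<open>The degree \<^term>\<open>m\<close> is indecomposable in the submonoid \<open>?T\<close> that supports the series below it, so the condition in
  \<^const>\<open>good\<close> at \<^term>\<open>m\<close> reads off the coefficient at \<^term>\<open>m\<close>.\<close>

lemma lquot_vanish:
  assumes g: "good \<delta> b g"
    and IH: "\<And>l. wt (codeg k) l < wt (codeg k) m \<Longrightarrow> l \<notin> slab b k \<Longrightarrow> lquot w (E k) g l = 0"
    and m: "wt (codeg k) m > 0" "m \<notin> slab b k" "wt (b k) m \<le> 0"
  shows "lquot w (E k) g m = 0"
proof -
  let ?h = "lquot w (E k) g" and ?T = "slab b k \<union> {l. wt (codeg k) m \<le> wt (codeg k) l}"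
  have ne: "m \<noteq> {#}" using m(1) by auto
  have T: "submonoid ?T"
    using submonoid_slab[of b k] codeg_nonneg[of k] unfolding submonoid_def
    by (auto intro: add_increasing add_increasing2)
  have sT: "supported ?h ?T" unfolding supported_def using IH by auto
  \<comment> \<open>A part outside the slab uses up the whole codegree of \<open>m\<close>. The
    other part then has codegree 0 and lies in the slab, where only \<open>{#}\<close> has codegree
    0.\<close>
  have ind: "u = {#} \<or> v = {#}" if "u \<in> ?T" "v \<in> ?T" "u + v = m" for u v
  proof (rule ccontr)
    assume n0: "\<not> (u = {#} \<or> v = {#})"
    have "\<not> (wt (codeg k) u = 0 \<and> u \<in> slab b k)" "\<not> (wt (codeg k) v = 0 \<and> v \<in> slab b k)"
      using n0 slab_multiples[of u k] slab_multiples[of v k] unfolding codeg_zero by blast+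
    moreover have "wt (codeg k) u + wt (codeg k) v = wt (codeg k) m" using that(3) by auto
    moreover have "\<not> (u \<in> slab b k \<and> v \<in> slab b k)"
      using m(2) that(3) submonoid_slab[of b k] by (auto simp: submonoid_def)
    moreover have "u \<in> slab b k \<or> wt (codeg k) m \<le> wt (codeg k) u" "v \<in> slab b k \<or> wt (codeg k) m \<le> wt (codeg k) v"
      using that(1,2) by blast+
    ultimately show False
      using m(1) codeg_nonneg[of k u] codeg_nonneg[of k v] by linarith
  qed
  have nk: "m \<notin> multiples k" using m(1) codeg_zero[of k m] by auto
  have "\<not> axis m"
  proof
    assume "axis m"
    then obtain i where i: "m \<in> multiples i" by (auto simp: axis_def)
    then have "i \<noteq> k" using nk by auto
    then have "count m k = 0" using i by (auto simp: multiples_def)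
    then show False using m(2) bplus_nonneg[of b k m] by (simp add: slab_def)
  qed
  then obtain u v u' where f: "factors w (col w m) g u v u'" "\<And>D. ell w D m v = 0"
    using g unfolding good_def by blast
  have "\<exists>u v u'. factors w (col w m) ?h u v u' \<and> (\<forall>D. ell w D m v = 0)"
    unfolding lquot_def
    by (rule factors_attach_left[OF skew_w f]) (use m(3) nk in \<open>auto simp: winv col_k_sign intro: supported_winv supported_dil_series submonoid_multiples\<close>)
  then obtain u v u' where f: "factors w (col w m) ?h u v u'" "\<And>D. ell w D m v = 0" by blast
  have s: "supported u ?T" "supported v ?T" "supported u' ?T" using factors_supported[OF f(1) sT T] by auto
  \<comment> \<open>By indecomposability the coefficient of the quotient at \<open>m\<close> is the
    sum of those of the three factors. Since \<omega>(m,m) = 0 only the middle one can contribute,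
    and the vanishing of \<open>ell\<close> kills it.\<close>
  have "ell w (codeg k) m v = wt (codeg k) m * v m"
    by (rule ell_indec[OF _ s(2) T ne ind]) (use f in \<open>auto simp: factors_def\<close>)
  then have "v m = 0" using f(2) m(1) by simp
  moreover have "wt (col w m) m = 0"
    using pair_skew[OF skew_w, of m m] by (simp add: pair_def)
  ultimately have "u m = 0 \<and> v m = 0 \<and> u' m = 0" using factors_sign[OF f(1) ne] by simp
  moreover have "mul w v u' m = v m * u' {#} + v {#} * u' m"
    by (rule mul_indec[OF ne s(2,3) ind])
  moreover have "mul w u (mul w v u') m = u m * mul w v u' {#} + u {#} * mul w v u' m"
    by (rule mul_indec[OF ne s(1) supported_mul_submonoid[OF s(2,3) T] ind])
  ultimately show ?thesis using f(1) by (simp add: factors_def)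
qed

lemma codeg_split: "k \<notin># n \<Longrightarrow> wt (codeg k) (n + replicate_mset a k) = wt (codeg k) n"
  by (simp add: codeg_def)

lemma slice_deg_le:
  assumes "k \<notin># n" "\<And>a. n + replicate_mset a k \<notin> slab b k \<Longrightarrow> f (n + replicate_mset a k) = 0"
  shows "deg_le (slice k f n) (nat (wt (bplus b k) n))"
  unfolding deg_le_def slice_def
proof (intro allI impI)
  fix i assume "nat (wt (bplus b k) n) < i"
  then have "n + replicate_mset i k \<notin> slab b k"
    using assms(1) by (simp add: slab_def not_in_iff bplus_def[of b k k])
  then show "fps_nth (Abs_fps (\<lambda>a. f (n + replicate_mset a k))) i = 0" using assms(2) by simp
qed

lemma bplus_neg_nat:
  assumes "wt (b k) n = - int r"
  shows "nat (wt (bplus (\<lambda>i j. - b i j) k) n) = nat (wt (bplus b k) n) + r"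
  using assms bplus_nonneg[of b k n] by (simp add: bplus_uminus nat_add_distrib)

text \<open>The slice through \<open>m\<close> has constant codegree and constant
  \<open>wt (b k)\<close>, so \<open>lquot_vanish\<close> bounds all of it. Multiplication by
  \<open>gauss_fps\<close> raises the bound by r = - \<open>wt (b k) m\<close>, and [b]_+ + r is the
  bound [-b]_+ for the right quotient.\<close>

lemma quot_step:
  assumes g: "good \<delta> b g"
    and IH: "\<And>l. wt (codeg k) l < wt (codeg k) m \<Longrightarrow> l \<notin> slab b k \<Longrightarrow> lquot w (E k) g l = 0"
    and m: "wt (codeg k) m > 0" "wt (b k) m \<le> 0"
  shows "(m \<notin> slab b k \<longrightarrow> lquot w (E k) g m = 0) \<and> (m \<notin> slab (\<lambda>i j. - b i j) k \<longrightarrow> rquot w (E k) g m = 0)"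
proof
  show "m \<notin> slab b k \<longrightarrow> lquot w (E k) g m = 0"
    using lquot_vanish[OF g IH m(1) _ m(2)] by blast
  show "m \<notin> slab (\<lambda>i j. - b i j) k \<longrightarrow> rquot w (E k) g m = 0"
  proof
    assume out: "m \<notin> slab (\<lambda>i j. - b i j) k"
    define n where "n = filter_mset (\<lambda>j. j \<noteq> k) m"
    have mn: "m = n + replicate_mset (count m k) k" unfolding n_def by (rule decomp)
    have k: "k \<notin># n" by (simp add: n_def)
    have J: "wt (codeg k) (n + replicate_mset a k) = wt (codeg k) m" for a
      using mn codeg_split[OF k] by metis
    have B: "wt (b k) (n + replicate_mset a k) = wt (b k) m" for a
      using arg_cong[OF mn, of "wt (b k)"] by simp
    define r where "r = nat (- wt (b k) m)"
    have r: "wt (b k) n = - int r" using B[of 0] m(2) by (simp add: r_def)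
    have "deg_le (slice k (lquot w (E k) g) n) (nat (wt (bplus b k) n))"
      by (rule slice_deg_le[OF k], rule lquot_vanish[OF g]) (use IH m J B in auto)
    then have "deg_le (slice k (rquot w (E k) g) n) (nat (wt (bplus (\<lambda>i j. - b i j) k) n))"
      unfolding slice_eq[OF k r] bplus_neg_nat[OF r] by (rule gauss_fps_deg_le)
    moreover have "count m k > nat (wt (bplus (\<lambda>i j. - b i j) k) n)"
    proof -
      have "wt (bplus (\<lambda>i j. - b i j) k) m = wt (bplus (\<lambda>i j. - b i j) k) n"
        by (subst mn) (simp add: bplus_def)
      then show ?thesis using out bplus_nonneg[of "\<lambda>i j. - b i j" k m] by (simp add: slab_def)
    qed
    ultimately have "fps_nth (slice k (rquot w (E k) g) n) (count m k) = 0" by (simp add: deg_le_def)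
    then show "rquot w (E k) g m = 0" using mn by (simp add: slice_def)
  qed
qed

end

text \<open>Both bounds go through one induction on the codegree: the half space
  \<open>wt (b k) m > 0\<close> is handled by the negated matrix, for which left and right quotient
  trade places.\<close>

lemma (in seed) quot_supported:
  assumes g: "good \<delta> b g"
  shows "supported (lquot w (E k) g) (slab b k)" "supported (rquot w (E k) g) (slab (\<lambda>i j. - b i j) k)"
proof -
  let ?nb = "\<lambda>i j. - b i j"
  interpret n: seed \<delta> ?nb by (rule neg)
  have gn: "good \<delta> ?nb g" by (rule good_neg[OF g])
  have "(m \<notin> slab b k \<longrightarrow> lquot w (E k) g m = 0) \<and> (m \<notin> slab ?nb k \<longrightarrow> rquot w (E k) g m = 0)" for m
  proof (induction "nat (wt (codeg k) m)" arbitrary: m rule: less_induct)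
    case less
    have IH: "(l \<notin> slab b k \<longrightarrow> lquot w (E k) g l = 0) \<and> (l \<notin> slab ?nb k \<longrightarrow> rquot w (E k) g l = 0)"
      if "wt (codeg k) l < wt (codeg k) m" for l
      using less[of l] that codeg_nonneg[of k l] by simp
    show ?case
    proof (cases "wt (codeg k) m = 0")
      case True
      then have "m \<in> multiples k" by (simp add: codeg_zero)
      then have "lquot w (E k) g m = one m" "rquot w (E k) g m = one m"
        using lquot_multiples[OF g] n.lquot_multiples[OF gn] by (simp_all add: symm_form_uminus rquot_neg)
      then show ?thesis by (auto simp: one_def slab_def)
    next
      case False
      then have pos: "wt (codeg k) m > 0" using codeg_nonneg[of k m] by simp
      show ?thesis
      proof (cases "wt (b k) m \<le> 0")
        case True
        show ?thesis by (rule quot_step[OF g _ pos True]) (use IH in auto)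
      next
        case False
        then have "wt (?nb k) m \<le> 0" by (simp add: wt_fun)
        from n.quot_step[OF gn _ pos this] IH
        show ?thesis by (simp add: symm_form_uminus rquot_neg)
      qed
    qed
  qed
  then show "supported (lquot w (E k) g) (slab b k)" "supported (rquot w (E k) g) (slab ?nb k)"
    by (auto simp: supported_def)
qed

subsection \<open>Mutation\<close>

text \<open>The dilogarithm is removed on the left and put back on the right, because mutation
  changes the sign of \<open>x k\<close>: what belonged to the positive factor now belongs to the
  negative one.\<close>

definition mut_series :: "('i \<Rightarrow> int) \<Rightarrow> ('i \<Rightarrow> 'i \<Rightarrow> int) \<Rightarrow> 'i \<Rightarrow> 'i ser \<Rightarrow> 'i ser" where
  "mut_series \<delta> b k g = mul (symm_form \<delta> (mut_b k b)) (push b k (lquot (symm_form \<delta> b) (dil_series (2 powi \<delta> k) k) g)) (dil_series (2 powi \<delta> k) k)"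

context seed
begin

abbreviation "w' k \<equiv> symm_form \<delta> (mut_b k b)"

lemma delta_max: "\<delta> i * max (- b i k) 0 = \<delta> k * max (b k i) 0"
  using delta_pos[of i] delta_pos[of k] skew_b[of i k] by (simp add: max_mult_distrib_left)

text \<open>Symmetrizability trades column \<open>k\<close> for row \<open>k\<close>; the two
  correction terms then visibly change places with opposite sign when \<open>i\<close> and
  \<open>j\<close> are swapped.\<close>

lemma mut_b_entry:
  assumes "i \<noteq> k" "j \<noteq> k"
  shows "\<delta> i * mut_b k b i j = \<delta> i * b i j + \<delta> k * (max (b k i) 0 * b k j) - \<delta> k * (b k i * max (b k j) 0)"
proof -
  have "\<delta> i * mut_b k b i j = \<delta> i * b i j + (\<delta> i * max (- b i k) 0) * b k j + (\<delta> i * b i k) * max (b k j) 0"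
    using assms by (simp add: mut_b_def algebra_simps)
  then show ?thesis unfolding delta_max skew_b[of i k] by (simp add: algebra_simps)
qed

lemma mut_b_seed: "seed \<delta> (mut_b k b)"
proof
  show "\<delta> i > 0" for i by (rule delta_pos)
  fix i j
  show "\<delta> i * mut_b k b i j = - (\<delta> j * mut_b k b j i)"
  proof (cases "i = k \<or> j = k")
    case True
    then show ?thesis using skew_b[of i j] by (auto simp: mut_b_def)
  next
    case False
    then show ?thesis using skew_b[of i j] by (simp add: mut_b_entry algebra_simps)
  qed
qed

lemma bplus_diag [simp]: "bplus b k k = 0"
  by (simp add: bplus_def)

lemma count_reflect: "count (reflect b k m) k = nat (wt (bplus b k) m) - count m k"
  by (simp add: reflect_def)

lemma filter_reflect: "filter_mset (\<lambda>j. j \<noteq> k) (reflect b k m) = filter_mset (\<lambda>j. j \<noteq> k) m"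
  by (rule multiset_eqI) (simp add: reflect_def)

lemma wt_reflect:
  assumes "m \<in> slab b k"
  shows "wt x (reflect b k m) = wt (trop_up b k x) m"
proof -
  have "trop_up b k x = (\<lambda>i. (x i + x k * bplus b k i) + (if i = k then - 2 * x k else 0))"
    by (auto simp: trop_up_def bplus_def mult.commute)
  then have "wt (trop_up b k x) m = wt x m + x k * wt (bplus b k) m + int (count m k) * (- 2 * x k)"
    by (simp only: wt_fun wt_point)
  moreover have "wt x (reflect b k m) = wt x m - int (count m k) * x k + (wt (bplus b k) m - int (count m k)) * x k"
    using assms bplus_nonneg[of b k m] by (simp add: reflect_def wt_filter slab_def of_nat_diff)
  ultimately show ?thesis by (simp add: algebra_simps)
qed

lemma wt_bplus_reflect: "wt (bplus b k) (reflect b k m) = wt (bplus b k) m"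
  by (simp add: reflect_def wt_filter)

lemma reflect_in: "m \<in> slab b k \<Longrightarrow> reflect b k m \<in> slab b k"
  using bplus_nonneg[of b k m] by (simp add: slab_def wt_bplus_reflect count_reflect)

lemma reflect_reflect: "m \<in> slab b k \<Longrightarrow> reflect b k (reflect b k m) = m"
  using bplus_nonneg[of b k m]
  by (subst reflect_def, intro multiset_eqI) (auto simp: filter_reflect wt_bplus_reflect count_reflect slab_def)

lemma reflect_add: "m \<in> slab b k \<Longrightarrow> l \<in> slab b k \<Longrightarrow> reflect b k (m + l) = reflect b k m + reflect b k l"
  using bplus_nonneg[of b k m] bplus_nonneg[of b k l]
  by (intro multiset_eqI) (auto simp: reflect_def slab_def)

lemma reflect_codeg: "wt (codeg k) (reflect b k m) = wt (codeg k) m"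
  by (simp add: reflect_def wt_filter codeg_def[of k k])

lemma reflect_empty [simp]: "reflect b k {#} = {#}"
  by (simp add: reflect_def)

lemma empty_slab: "{#} \<in> slab b k"
  by (simp add: slab_def)

text \<open>Mutation of the form is the base change e_k -> - e_k, e_i -> e_i + [b_ki]_+ e_k. On the
  slab \<open>reflect\<close> is this base change, hence an isometry, and \<open>trop_up\<close> is
  its transpose.\<close>

lemma col_mut_b:
  assumes "m \<in> slab b k"
  shows "col (w' k) m = trop_up b k (col w (reflect b k m))"
proof
  fix j
  have c: "col w (reflect b k m) j = wt (trop_up b k (\<lambda>i. w i j)) m" for j
    unfolding col_def by (rule wt_reflect[OF assms])
  have wkk: "w k k = 0" by (simp add: symm_form_def)
  show "col (w' k) m j = trop_up b k (col w (reflect b k m)) j"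
  proof (cases "j = k")
    case True
    have "col (w' k) m k = wt (\<lambda>i. - trop_up b k (\<lambda>i. w i k) i) m"
      unfolding col_def by (rule wt_cong) (auto simp: symm_form_def trop_up_def mut_b_def)
    then show ?thesis unfolding wt_fun(2) by (simp add: True c trop_up_def[of b k "col w (reflect b k m)"])
  next
    case False
    have "col (w' k) m j = wt (\<lambda>i. trop_up b k (\<lambda>i. w i j) i + max (b k j) 0 * trop_up b k (\<lambda>i. w i k) i) m"
      unfolding col_def
    proof (rule wt_cong)
      fix i
      show "w' k i j = trop_up b k (\<lambda>i. w i j) i + max (b k j) 0 * trop_up b k (\<lambda>i. w i k) i"
      proof (cases "i = k")
        case True
        then show ?thesis using False by (simp add: symm_form_def trop_up_def mut_b_def)
      next
        case i: False
        have "w' k i j = \<delta> i * b i j + \<delta> k * (max (b k i) 0 * b k j) + (- (\<delta> k * b k i)) * max (b k j) 0"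
          unfolding symm_form_def mut_b_entry[OF i False] by simp
        also have "\<dots> = w i j + max (b k i) 0 * w k j + max (b k j) 0 * w i k"
          unfolding skew_b[of i k, symmetric] symm_form_def by (simp add: algebra_simps)
        finally show ?thesis using i wkk by (simp add: trop_up_def)
      qed
    qed
    also have "\<dots> = col w (reflect b k m) j + max (b k j) 0 * col w (reflect b k m) k"
      unfolding wt_fun(1,3) c ..
    finally show ?thesis using False by (simp add: trop_up_def)
  qed
qed

lemma wt_col_mut_b:
  "m \<in> slab b k \<Longrightarrow> l \<in> slab b k \<Longrightarrow> wt (col (w' k) m) l = wt (col w (reflect b k m)) (reflect b k l)"
  by (simp add: col_mut_b wt_reflect)

lemma filter_replicate: "i \<noteq> k \<Longrightarrow> filter_mset (\<lambda>j. j \<noteq> k) (replicate_mset a i) = replicate_mset a i"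
  by (induction a) simp_all

lemma supported_push_mono:
  "supported f A \<Longrightarrow> (\<And>l. l \<in> slab b k \<Longrightarrow> reflect b k l \<in> A \<Longrightarrow> l \<in> A') \<Longrightarrow> supported (push b k f) A'"
  unfolding supported_def push_def by metis

lemma supported_push: "supported (push b k f) (slab b k)"
  by (simp add: supported_def push_def)

lemma push_empty: "push b k f {#} = f {#}"
  by (simp add: push_def empty_slab)

text \<open>On the slab \<open>reflect\<close> is an additive isometric involution, so
  \<open>push\<close> is multiplicative on series supported there.\<close>

lemma push_mul:
  assumes "supported f (slab b k)" "supported g (slab b k)"
  shows "mul (w' k) (push b k f) (push b k g) = push b k (mul w f g)"
proof
  fix m
  let ?S = "slab b k" and ?R = "reflect b k"
  show "mul (w' k) (push b k f) (push b k g) m = push b k (mul w f g) m"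
  proof (cases "m \<in> ?S")
    case False
    have "supported (mul (w' k) (push b k f) (push b k g)) ?S"
      by (intro supported_mul_submonoid supported_push submonoid_slab)
    then show ?thesis using False by (simp add: supported_def push_def)
  next
    case True
    have "mul (w' k) (push b k f) (push b k g) m
      = (\<Sum>p\<in>{p \<in> splits m. fst p \<in> ?S \<and> snd p \<in> ?S}. 2 powi pair (w' k) (fst p) (snd p) * (push b k f (fst p) * push b k g (snd p)))"
      unfolding mul_eq by (rule sum.mono_neutral_right) (auto simp: push_def)
    also have "\<dots> = (\<Sum>p\<in>{p \<in> splits (?R m). fst p \<in> ?S \<and> snd p \<in> ?S}. 2 powi pair w (fst p) (snd p) * (f (fst p) * g (snd p)))"
    proof (rule sum.reindex_bij_witness[of _ "\<lambda>(u, v). (?R u, ?R v)" "\<lambda>(u, v). (?R u, ?R v)"])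
      fix p assume "p \<in> {p \<in> splits m. fst p \<in> ?S \<and> snd p \<in> ?S}"
      moreover obtain u v where p: "p = (u, v)" by (cases p)
      ultimately have uv: "u \<in> ?S" "v \<in> ?S" "u + v = m" by auto
      show "(case case p of (u, v) \<Rightarrow> (?R u, ?R v) of (u, v) \<Rightarrow> (?R u, ?R v)) = p"
        using uv by (simp add: p reflect_reflect)
      show "(case p of (u, v) \<Rightarrow> (?R u, ?R v)) \<in> {p \<in> splits (?R m). fst p \<in> ?S \<and> snd p \<in> ?S}"
        using uv by (auto simp: p reflect_in reflect_add)
      show "2 powi pair w (fst (case p of (u, v) \<Rightarrow> (?R u, ?R v))) (snd (case p of (u, v) \<Rightarrow> (?R u, ?R v))) *
          (f (fst (case p of (u, v) \<Rightarrow> (?R u, ?R v))) * g (snd (case p of (u, v) \<Rightarrow> (?R u, ?R v)))) =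
          2 powi pair (w' k) (fst p) (snd p) * (push b k f (fst p) * push b k g (snd p))"
        using uv by (simp add: p push_def pair_def wt_col_mut_b)
    next
      fix p assume "p \<in> {p \<in> splits (?R m). fst p \<in> ?S \<and> snd p \<in> ?S}"
      moreover obtain u v where p: "p = (u, v)" by (cases p)
      ultimately have uv: "u \<in> ?S" "v \<in> ?S" "u + v = ?R m" by auto
      show "(case case p of (u, v) \<Rightarrow> (?R u, ?R v) of (u, v) \<Rightarrow> (?R u, ?R v)) = p"
        using uv by (simp add: p reflect_reflect)
      have "?R u + ?R v = m" using uv True by (metis reflect_add reflect_reflect)
      then show "(case p of (u, v) \<Rightarrow> (?R u, ?R v)) \<in> {p \<in> splits m. fst p \<in> ?S \<and> snd p \<in> ?S}"
        using uv by (auto simp: p reflect_in)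
    qed
    also have "\<dots> = mul w f g (?R m)"
      unfolding mul_eq by (rule sum.mono_neutral_left) (use assms in \<open>auto simp: supported_def\<close>)
    finally show ?thesis using True by (simp add: push_def)
  qed
qed

lemma push_one: "push b k one = one"
proof
  fix m
  show "push b k one m = one m"
  proof (cases "m \<in> slab b k")
    case True
    then have "reflect b k m = {#} \<longleftrightarrow> m = {#}" by (metis reflect_empty reflect_reflect)
    then show ?thesis using True by (simp add: push_def one_def)
  next
    case False
    then show ?thesis using empty_slab by (auto simp: push_def one_def)
  qed
qed

lemma push_winv:
  assumes "supported f (slab b k)" "f {#} = 1"
  shows "winv (w' k) (push b k f) = push b k (winv w f)"
  by (rule winv_unique) (use assms in \<open>simp_all add: push_empty push_mul supported_winv submonoid_slab winv push_one\<close>)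

text \<open>The codegree is invariant under \<open>reflect\<close>, so its derivation commutes with
  \<open>push\<close>.\<close>

lemma push_ell:
  assumes "supported u (slab b k)" "u {#} = 1" "n \<in> slab b k"
  shows "ell (w' k) (codeg k) n (push b k u) = ell w (codeg k) (reflect b k n) u"
proof -
  have "der (codeg k) (push b k u) = push b k (der (codeg k) u)"
    by (auto simp: der_def push_def reflect_codeg)
  then show ?thesis
    using assms by (simp add: ell_def push_winv push_mul supported_winv submonoid_slab supported_der) (simp add: push_def)
qed

lemma push_factors:
  assumes f: "factors w x h u v u'" and s: "supported h (slab b k)"
    and x: "\<And>l. l \<in> slab b k \<Longrightarrow> wt x' l = wt x (reflect b k l)"
  shows "factors (w' k) x' (push b k h) (push b k u) (push b k v) (push b k u')"
proof -
  have S: "supported u (slab b k)" "supported v (slab b k)" "supported u' (slab b k)"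
    using factors_supported[OF f s submonoid_slab] by auto
  have r: "reflect b k l = {#} \<Longrightarrow> l \<in> slab b k \<Longrightarrow> l = {#}" for l
    by (metis reflect_empty reflect_reflect)
  have "push b k h = mul (w' k) (push b k u) (mul (w' k) (push b k v) (push b k u'))"
    using f S by (simp add: push_mul supported_mul_submonoid submonoid_slab factors_def)
  moreover have "supported (push b k u) (pset x')" "supported (push b k v) (zset x')" "supported (push b k u') (nset x')"
    using f x r unfolding factors_def
    by (auto intro!: supported_push_mono[of u "pset x"] supported_push_mono[of v "zset x"] supported_push_mono[of u' "nset x"]
        simp: pset_def zset_def nset_def)
  ultimately show ?thesis using f by (simp add: factors_def push_empty)
qed

lemma slice_push:
  assumes "k \<notin># n"
  shows "slice k (push b k f) n = rev_fps (nat (wt (bplus b k) n)) (slice k f n)"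
proof (rule fps_ext)
  fix a
  have k0: "count n k = 0" using assms by (simp add: not_in_iff)
  have P: "wt (bplus b k) (n + replicate_mset a k) = wt (bplus b k) n" by simp
  have "n + replicate_mset a k \<in> slab b k \<longleftrightarrow> a \<le> nat (wt (bplus b k) n)"
    using bplus_nonneg[of b k n] by (auto simp: slab_def P k0)
  moreover have "reflect b k (n + replicate_mset a k) = n + replicate_mset (nat (wt (bplus b k) n) - a) k"
    unfolding reflect_def P by (rule multiset_eqI) (simp add: k0)
  ultimately show "fps_nth (slice k (push b k f) n) a = fps_nth (rev_fps (nat (wt (bplus b k) n)) (slice k f n)) a"
    by (simp add: slice_def push_def rev_fps_def)
qed

lemma mul_E_axis: "k \<notin># n \<Longrightarrow> mul w (E k) f n = f n" "k \<notin># n \<Longrightarrow> mul w f (E k) n = f n"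
proof -
  assume k: "k \<notin># n"
  have "fps_nth (slice k (mul w (E k) f) n) 0 = fps_nth (slice k f n) 0"
    unfolding slice_mul_left[OF skew_w k wt_w refl] by (simp add: dil_fps_def)
  then show "mul w (E k) f n = f n" by (simp add: slice_def)
  have "fps_nth (slice k (mul w f (E k)) n) 0 = fps_nth (slice k f n) 0"
    unfolding slice_mul_right[OF skew_w k wt_w refl] by (simp add: dil_fps_def)
  then show "mul w f (E k) n = f n" by (simp add: slice_def)
qed

end

text \<open>Both crossings of the wall \<^term>\<open>k\<close> give the same mutated series because the wall-crossing polynomial
  \<^const>\<open>gauss_fps\<close> is palindromic. Together with the symmetry $b \mapsto -b$, which passes to the opposite algebra, this
  reduces every statement about mutation to one of the two half spaces.\<close>

lemma (in seed) mut_series_slices: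
  assumes g: "good \<delta> b g" and k: "k \<notin># n" and r: "wt (b k) n = - int r"
  shows "slice k (mul (w' k) (push b k (lquot w (E k) g)) (E k)) n
    = slice k (mul (w' k) (E k) (push (\<lambda>i j. - b i j) k (rquot w (E k) g))) n"
proof -
  interpret m: seed \<delta> "mut_b k b" by (rule mut_b_seed)
  interpret n: seed \<delta> "\<lambda>i j. - b i j" by (rule neg)
  let ?F = "slice k (lquot w (E k) g) n" and ?N = "nat (wt (bplus b k) n)"
  have "mut_b k b k = (\<lambda>j. - b k j)" by (auto simp: mut_b_def)
  then have "wt (w' k k) n = \<delta> k * int r" using r by (simp add: m.wt_w wt_fun)
  note W = this
  have d: "deg_le ?F ?N"
    by (rule slice_deg_le[OF k]) (use quot_supported(1)[OF g] in \<open>simp add: supported_def\<close>)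
  have L: "slice k (mul (w' k) (push b k (lquot w (E k) g)) (E k)) n = dil_fps (q k) (1 / q k ^ r) * rev_fps ?N ?F"
    using slice_mul_right[OF m.skew_w k W refl] by (simp add: slice_push[OF k] power_int_minus divide_inverse)
  have "slice k (mul (w' k) (E k) (push (\<lambda>i j. - b i j) k (rquot w (E k) g))) n
    = dil_fps (q k) (q k ^ r) * rev_fps (?N + r) (gauss_fps (q k) r * ?F)"
    using slice_mul_left[OF m.skew_w k W refl]
    by (simp add: n.slice_push[OF k] bplus_neg_nat[OF r] slice_eq[OF k r])
  also have "\<dots> = dil_fps (q k) (q k ^ r) * (gauss_fps (q k) r * rev_fps ?N ?F)"
    by (simp add: gauss_fps_rev[OF q_gt_1 d])
  finally show ?thesis unfolding L dil_fps_gauss_fps[OF q_gt_1] by (simp add: mult_ac)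
qed

lemma (in seed) mut_series_neg:
  assumes g: "good \<delta> b g"
  shows "mut_series \<delta> (\<lambda>i j. - b i j) k g = mut_series \<delta> b k g"
proof -
  let ?nb = "\<lambda>i j. - b i j"
  interpret m: seed \<delta> "mut_b k b" by (rule mut_b_seed)
  interpret n: seed \<delta> ?nb by (rule neg)
  have A: "mut_series \<delta> ?nb k g = mul (w' k) (E k) (push ?nb k (rquot w (E k) g))"
    by (simp add: mut_series_def symm_form_uminus mut_b_uminus rquot_neg mul_opp[OF m.skew_w])
  have "slice k (mul (w' k) (push b k (lquot w (E k) g)) (E k)) n
    = slice k (mul (w' k) (E k) (push ?nb k (rquot w (E k) g))) n" if k: "k \<notin># n" for n
  proof (cases "wt (b k) n \<le> 0")
    case True
    show ?thesis by (rule mut_series_slices[OF g k, of "nat (- wt (b k) n)"]) (use True in simp)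
  next
    case False
    have "wt (?nb k) n = - int (nat (wt (b k) n))" using False by (simp add: wt_fun)
    from n.mut_series_slices[OF good_neg[OF g] k this] show ?thesis
      by (simp add: symm_form_uminus mut_b_uminus rquot_neg mul_opp[OF m.skew_w])
  qed
  then have "mul (w' k) (push b k (lquot w (E k) g)) (E k) = mul (w' k) (E k) (push ?nb k (rquot w (E k) g))"
    by (rule slice_eqI)
  then show ?thesis unfolding A mut_series_def[of \<delta> b] by simp
qed

context seed
begin

lemma supported_lquot: "good \<delta> b g \<Longrightarrow> supported (lquot w (E k) g) (slab b k)"
  by (rule quot_supported)

lemma lquot_empty: "good \<delta> b g \<Longrightarrow> lquot w (E k) g {#} = 1"
  by (simp add: lquot_def winv good_empty)

text \<open>In this half space the dilogarithm can be put back on the right without disturbing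
  \<open>ell\<close>. For \<open>n\<close> in the slab, its reflection has the opposite sign at
  \<open>k\<close>, so there the dilogarithm could be removed on the left just as
  harmlessly.\<close>

lemma factors_mut_series:
  assumes g: "good \<delta> b g" and n: "\<not> axis n" and neg: "col (w' k) n k \<le> 0"
  shows "\<exists>u v u'. factors (w' k) (col (w' k) n) (mut_series \<delta> b k g) u v u' \<and> (\<forall>D. ell (w' k) D n v = 0)"
proof -
  interpret m: seed \<delta> "mut_b k b" by (rule mut_b_seed)
  let ?H = "push b k (lquot w (E k) g)"
  have nk: "n \<notin> multiples k" using n by (auto simp: axis_def)
  have "\<exists>u v u'. factors (w' k) (col (w' k) n) ?H u v u' \<and> (\<forall>D. ell (w' k) D n v = 0)"
  proof (cases "n \<in> slab b k")
    case False
    have "?H {#} = 1" using g by (simp add: push_empty lquot_empty)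
    then obtain u v u' where f: "factors (w' k) (col (w' k) n) ?H u v u'" using factors_exists by blast
    have "supported v (slab b k)" using factors_supported[OF f supported_push submonoid_slab] by blast
    then have "ell (w' k) D n v = 0" for D
      using f False by (intro ell_zero[OF _ _ submonoid_slab]) (auto simp: factors_def)
    then show ?thesis using f by blast
  next
    case True
    let ?n = "reflect b k n"
    have x: "col w ?n k \<ge> 0" using neg by (simp add: col_mut_b[OF True] trop_up_def)
    \<comment> \<open>An axis other than that of \<open>k\<close> on which \<open>b k i <= 0\<close>
      is fixed by the reflection, so \<open>n\<close> would lie on it as well.\<close>
    have na: "\<not> axis ?n"
    proof
      assume "axis ?n"
      then obtain i where i: "?n \<in> multiples i" by (auto simp: axis_def)
      have "n \<in> multiples i"
      proof (cases "i = k")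
        case True
        then have "?n = {#}" using slab_multiples[OF reflect_in[OF \<open>n \<in> slab b k\<close>]] i by simp
        then have "n = {#}" using reflect_reflect[OF \<open>n \<in> slab b k\<close>] by simp
        then show ?thesis by (simp add: in_multiples)
      next
        case False
        from i obtain a where a: "?n = replicate_mset a i" by (auto simp: multiples_def)
        have "int a * b k i \<le> 0" using x by (simp add: col_k_sign a)
        then have "wt (bplus b k) ?n = 0" by (auto simp: a bplus_def mult_le_0_iff)
        then have "reflect b k ?n = ?n" using False by (subst reflect_def) (auto simp: a filter_replicate)
        then show ?thesis using reflect_reflect[OF \<open>n \<in> slab b k\<close>] i by simp
      qed
      then show False using n by (auto simp: axis_def)
    qed
    then obtain u v u' where f: "factors w (col w ?n) g u v u'" "\<And>D. ell w D ?n v = 0"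
      using g unfolding good_def by blast
    have "\<exists>u v u'. factors w (col w ?n) (lquot w (E k) g) u v u' \<and> (\<forall>D. ell w D ?n v = 0)"
      unfolding lquot_def
      by (rule factors_attach_left[OF skew_w f])
        (use x na in \<open>auto simp: winv axis_def intro: supported_winv supported_dil_series submonoid_multiples\<close>)
    then obtain u v u' where f: "factors w (col w ?n) (lquot w (E k) g) u v u'" "\<And>D. ell w D ?n v = 0" by blast
    have sv: "supported v (slab b k)" using factors_supported[OF f(1) supported_lquot[OF g] submonoid_slab] by blast
    have F: "factors (w' k) (col (w' k) n) ?H (push b k u) (push b k v) (push b k u')"
      by (rule push_factors[OF f(1) supported_lquot[OF g]]) (rule wt_col_mut_b[OF True])
    have v1: "v {#} = 1" using f(1) by (simp add: factors_def)
    have e0: "ell (w' k) (codeg k) n (push b k v) = 0"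
      using f(2) by (simp add: push_ell[OF sv v1 True])
    \<comment> \<open>Vanishing spreads from \<open>codeg k\<close> to every derivation, as
      \<open>n\<close> has nonzero codegree.\<close>
    have "ell (w' k) D n (push b k v) = 0" for D
    proof -
      have "wt (codeg k) n * ell (w' k) D n (push b k v) = wt D n * ell (w' k) (codeg k) n (push b k v)"
        by (rule ell_change[OF m.skew_w]) (use F in \<open>auto simp: factors_def\<close>)
      then show ?thesis using e0 nk codeg_zero[of k n] by simp
    qed
    then show ?thesis using F by blast
  qed
  then obtain u v u' where "factors (w' k) (col (w' k) n) ?H u v u'" "\<And>D. ell (w' k) D n v = 0" by blast
  from factors_attach_right[OF m.skew_w this supported_dil_series _ neg nk]
  show ?thesis unfolding mut_series_def by simp
qed

lemma mut_series_multiples: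
  assumes g: "good \<delta> b g"
  shows "mut_series \<delta> b k g (replicate_mset a k) = dil (q k) a"
proof -
  interpret m: seed \<delta> "mut_b k b" by (rule mut_b_seed)
  let ?H = "push b k (lquot w (E k) g)"
  have "?H (replicate_mset c k) = one (replicate_mset c k)" for c
  proof (cases "c = 0")
    case True
    then show ?thesis using g by (simp add: push_empty lquot_empty)
  next
    case False
    then show ?thesis using slab_multiples[of "replicate_mset c k" k] by (auto simp: push_def multiples_def one_def)
  qed
  then have "slice k ?H {#} = 1" by (intro fps_ext) (simp add: slice_def one_def)
  then have "slice k (mut_series \<delta> b k g) {#} = dil_fps (q k) 1"
    using slice_mul_right[OF m.skew_w, of k "{#}" "\<delta> k" 0 "q k" ?H] by (simp add: mut_series_def)
  then have "fps_nth (slice k (mut_series \<delta> b k g) {#}) a = fps_nth (dil_fps (q k) 1) a" by simp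
  then show ?thesis by (simp add: slice_def dil_fps_def)
qed

text \<open>For \<open>b k i <= 0\<close> the reflection fixes the multiples of \<open>e_i\<close>,
  and multiplying by a dilogarithm in \<open>X_k\<close> does not change coefficients in degrees
  without \<open>k\<close>. The other sign is reached through the negated matrix.\<close>

lemma mut_series_axis:
  assumes g: "good \<delta> b g" and i: "i \<noteq> k" "b k i \<le> 0"
  shows "mut_series \<delta> b k g (replicate_mset a i) = dil (q i) a"
proof -
  interpret m: seed \<delta> "mut_b k b" by (rule mut_b_seed)
  let ?n = "replicate_mset a i"
  have k: "k \<notin># ?n" using i by auto
  have P: "wt (bplus b k) ?n = 0" using i by (simp add: bplus_def)
  have "reflect b k ?n = ?n" unfolding reflect_def P using i by (simp add: filter_replicate)
  moreover have "?n \<in> slab b k" using i P by (auto simp: slab_def)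
  ultimately have "mut_series \<delta> b k g ?n = lquot w (E k) g ?n"
    by (simp add: mut_series_def m.mul_E_axis[OF k] push_def)
  also have "\<dots> = g ?n" using mul_E_axis(1)[OF k, of "lquot w (E k) g"] by (simp add: mul_lquot)
  finally show ?thesis using g by (simp add: good_def)
qed

end

lemma (in seed) good_mut_series:
  assumes g: "good \<delta> b g"
  shows "good \<delta> (mut_b k b) (mut_series \<delta> b k g)"
  unfolding good_def
proof (intro conjI allI impI)
  let ?nb = "\<lambda>i j. - b i j"
  interpret m: seed \<delta> "mut_b k b" by (rule mut_b_seed)
  interpret n: seed \<delta> ?nb by (rule neg)
  have gn: "good \<delta> ?nb g" by (rule good_neg[OF g])
  show "mut_series \<delta> b k g (replicate_mset a i) = dil (q i) a" for i a
  proof (cases "i = k")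
    case True
    then show ?thesis using mut_series_multiples[OF g] by simp
  next
    case False
    then show ?thesis
      using mut_series_axis[OF g False, of a] n.mut_series_axis[OF gn False, of a] mut_series_neg[OF g] by fastforce
  qed
  fix n :: "'i multiset" assume na: "\<not> axis n"
  show "\<exists>u v u'. factors (w' k) (col (w' k) n) (mut_series \<delta> b k g) u v u' \<and> (\<forall>D. ell (w' k) D n v = 0)"
  proof (cases "col (w' k) n k \<le> 0")
    case True
    then show ?thesis by (rule factors_mut_series[OF g na])
  next
    case False
    then have "col (n.w' k) n k \<le> 0" by (simp add: symm_form_uminus mut_b_uminus col_uminus)
    from n.factors_mut_series[OF gn na this]
    obtain u v u' where "factors (n.w' k) (col (n.w' k) n) (mut_series \<delta> b k g) u v u'" "\<And>D. ell (n.w' k) D n v = 0"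
      by (auto simp: mut_series_neg[OF g])
    from factors_opp_ell[OF _ this] show ?thesis
      using skew_uminus[OF m.skew_w] by (auto simp: symm_form_uminus mut_b_uminus)
  qed
qed

section \<open>Transport of points that lie on no wall\<close>

text \<open>For \<open>x k > 0\<close> the inverse dilogarithm is absorbed by the positive factor;
  after \<open>push\<close> the point is negative at \<open>k\<close>, and the dilogarithm put back
  on the right is absorbed by the negative factor. The middle factor stays \<open>one\<close>
  throughout.\<close>

lemma (in seed) wall_free_up:
  assumes g: "good \<delta> b g" and t: "wall_free w x g" and pos: "x k > 0"
  shows "wall_free (w' k) (trop_up b k x) (mut_series \<delta> b k g)"
proof -
  let ?x = "trop_up b k x" and ?h = "lquot w (E k) g"
  obtain a c where f: "factors w x g a one c" using t by (auto simp: wall_free_def)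
  have i: "supported (winv w (E k)) (multiples k)" by (intro supported_winv supported_dil_series submonoid_multiples) simp
  have "multiples k \<subseteq> pset x"
  proof
    fix m assume "m \<in> multiples k"
    then obtain i where "m = replicate_mset i k" by (auto simp: multiples_def)
    then show "m \<in> pset x" using pos by (cases "i = 0") (auto simp: pset_def)
  qed
  then have "supported (mul w (winv w (E k)) a) (pset x)"
    using f by (intro supported_mul_submonoid submonoid_sets supported_mono[OF i]) (auto simp: factors_def)
  then have "factors w x ?h (mul w (winv w (E k)) a) one c"
    using f by (auto simp: factors_def lquot_def mul_assoc winv)
  from push_factors[OF this supported_lquot[OF g] wt_reflect[symmetric]]
  obtain a' c' where f': "factors (w' k) ?x (push b k ?h) a' one c'" by (auto simp: push_one)
  have "multiples k \<subseteq> nset ?x"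
  proof
    fix m assume "m \<in> multiples k"
    then obtain i where "m = replicate_mset i k" by (auto simp: multiples_def)
    then show "m \<in> nset ?x" using pos by (cases "i = 0") (auto simp: nset_def trop_up_def)
  qed
  then have "supported (mul (w' k) c' (E k)) (nset ?x)"
    using f' by (intro supported_mul_submonoid submonoid_sets supported_mono[OF supported_dil_series]) (auto simp: factors_def)
  then have "factors (w' k) ?x (mut_series \<delta> b k g) a' one (mul (w' k) c' (E k))"
    using f' by (auto simp: factors_def mut_series_def mul_assoc)
  then show ?thesis by (auto simp: wall_free_def)
qed

lemma wall_free_opp: "skew w \<Longrightarrow> wall_free w x g \<Longrightarrow> wall_free (\<lambda>i j. - w i j) (\<lambda>i. - x i) g"
  unfolding wall_free_def using factors_opp by blast

lemma (in seed) wall_free_down: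
  assumes g: "good \<delta> b g" and t: "wall_free w x g" and neg': "x k < 0"
  shows "wall_free (w' k) (\<lambda>i. if i = k then - x k else x i + max (- b k i) 0 * x k) (mut_series \<delta> b k g)"
proof -
  interpret m: seed \<delta> "mut_b k b" by (rule mut_b_seed)
  interpret n: seed \<delta> "\<lambda>i j. - b i j" by (rule neg)
  have "wall_free n.w (\<lambda>i. - x i) g" using wall_free_opp[OF skew_w t] by (simp add: symm_form_uminus)
  then have "wall_free (n.w' k) (trop_up (\<lambda>i j. - b i j) k (\<lambda>i. - x i)) (mut_series \<delta> b k g)"
    using n.wall_free_up[OF good_neg[OF g]] neg' by (simp add: mut_series_neg[OF g])
  then have "wall_free (w' k) (\<lambda>i. - trop_up (\<lambda>i j. - b i j) k (\<lambda>i. - x i) i) (mut_series \<delta> b k g)"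
    using wall_free_opp[OF skew_uminus[OF m.skew_w]] by (simp add: symm_form_uminus mut_b_uminus)
  moreover have "(\<lambda>i. - trop_up (\<lambda>i j. - b i j) k (\<lambda>i. - x i) i) = (\<lambda>i. if i = k then - x k else x i + max (- b k i) 0 * x k)"
    by (auto simp: trop_up_def)
  ultimately show ?thesis by simp
qed

section \<open>Existence of the initial series and the walls of the initial variables\<close>

lemma (in seed) good_exists: "\<exists>g. good \<delta> b g"
proof -
  \<comment> \<open>Constant term 1 is forced so that arbitrary iterates have a
    factorization.\<close>
  define nrm where "nrm g = g({#} := 1)" for g :: "'i ser"
  define mid where "mid x g = (SOME v. \<exists>u u'. factors w x g u v u')" for x g
  define L where "L g m = ell w (\<lambda>_. 1) m (mid (col w m) (nrm g))" for g m
  \<comment> \<open>With the smaller degrees fixed, \<open>L g m\<close> is affine in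
    \<open>g m\<close> with slope \<open>size m\<close>. The difference is therefore free of
    \<open>g m\<close>, and a fixed point has \<open>L g m = 0\<close> off the axes.\<close>
  define \<Phi> where "\<Phi> g m = (if m = {#} then 1 else if axis m then dil (q (SOME i. i \<in># m)) (size m)
    else nrm g m - L g m / size m)" for g m
  have mid: "\<exists>u u'. factors w x g u (mid x g) u'" if "g {#} = 1" for x g
  proof -
    have "\<exists>v u u'. factors w x g u v u'" using factors_exists[of g w x] that by blast
    then show ?thesis unfolding mid_def by (rule someI_ex)
  qed
  have size: "wt (\<lambda>_. 1) m = int (size m)" for m :: "'i multiset"
    by (induction m) simp_all
  have perp: "wt (col w m) m = 0" for m
    using pair_skew[OF skew_w, of m m] by (simp add: pair_def)
  have "\<Phi> g m = \<Phi> g' m" if ag: "agree (size m) g g'" for g g' m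
  proof (cases "m = {#} \<or> axis m")
    case False
    have ag': "agree (size m) (nrm g) (nrm g')" using ag by (simp add: agree_def nrm_def)
    obtain u u' where f: "factors w (col w m) (nrm g) u (mid (col w m) (nrm g)) u'"
      using mid[of "nrm g" "col w m"] by (auto simp: nrm_def)
    obtain v v' where f': "factors w (col w m) (nrm g') v (mid (col w m) (nrm g')) v'"
      using mid[of "nrm g'" "col w m"] by (auto simp: nrm_def)
    let ?b = "mid (col w m) (nrm g)" and ?b' = "mid (col w m) (nrm g')"
    have a: "agree (size m) u v" "agree (size m) ?b ?b'" "agree (size m) u' v'"
      using factors_agree[OF f f' ag'] by auto
    have "?b m - ?b' m = nrm g m - nrm g' m"
      using factors_diff[OF f f' _ a] factors_sign[OF f, of m] factors_sign[OF f', of m] perp False by simp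
    moreover have "L g m - L g' m = real (size m) * (?b m - ?b' m)"
      unfolding L_def using ell_diff[OF _ _ _ a(2), of w "\<lambda>_. 1"] f f' False by (simp add: factors_def size)
    moreover have "size m \<noteq> 0" using False by simp
    ultimately have "L g m / size m - L g' m / size m = nrm g m - nrm g' m"
      by (simp add: diff_divide_distrib[symmetric])
    then show ?thesis using False by (simp add: \<Phi>_def)
  qed (auto simp: \<Phi>_def)
  from contraction_fixpoint[of \<Phi>, OF this] obtain g where g: "\<Phi> g = g" by blast
  have g1: "g {#} = 1" using fun_cong[OF g, of "{#}"] by (simp add: \<Phi>_def)
  then have nrm: "nrm g = g" by (auto simp: nrm_def)
  have "good \<delta> b g"
    unfolding good_def
  proof (intro conjI allI impI)
    fix i a
    show "g (replicate_mset a i) = dil (q i) a"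
    proof (cases a)
      case (Suc a')
      have "replicate_mset a i \<in> multiples i" by (simp add: multiples_def)
      then have "axis (replicate_mset a i)" unfolding axis_def by blast
      moreover have "replicate_mset a i \<noteq> {#}" using Suc by simp
      moreover have "(SOME j. j \<in># replicate_mset a i) = i" using Suc by auto
      ultimately show ?thesis using fun_cong[OF g, of "replicate_mset a i"] by (simp add: \<Phi>_def)
    qed (simp add: g1)
  next
    fix n :: "'i multiset" assume n: "\<not> axis n"
    then have ne: "n \<noteq> {#}" by (auto simp: axis_def in_multiples)
    obtain u u' where f: "factors w (col w n) g u (mid (col w n) g) u'" using mid[of g "col w n"] g1 by blast
    have "L g n = 0" using fun_cong[OF g, of n] n ne by (simp add: \<Phi>_def nrm)
    then have e: "ell w (\<lambda>_. 1) n (mid (col w n) g) = 0" by (simp add: L_def nrm)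
    have "ell w D n (mid (col w n) g) = 0" for D
    proof -
      have "wt (\<lambda>_. 1) n * ell w D n (mid (col w n) g) = wt D n * ell w (\<lambda>_. 1) n (mid (col w n) g)"
        by (rule ell_change[OF skew_w]) (use f in \<open>auto simp: factors_def\<close>)
      then show ?thesis using e ne by (simp add: size)
    qed
    then show "\<exists>u v u'. factors w (col w n) g u v u' \<and> (\<forall>D. ell w D n v = 0)" using f by blast
  qed
  then show ?thesis by blast
qed

text \<open>The degree \<open>e_i\<close> is indecomposable. If \<open>x i = 0\<close>, only the
  middle factor could supply the nonzero first dilogarithm coefficient there, but that factor is
  \<open>one\<close>.\<close>

lemma (in seed) wall_free_nonzero:
  assumes g: "good \<delta> b g" and t: "wall_free w x g"
  shows "x i \<noteq> 0"
proof
  assume x: "x i = 0"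
  obtain a c where f: "factors w x g a one c" using t by (auto simp: wall_free_def)
  have "mul w a c {#i#} = a {#i#} * c {#} + a {#} * c {#i#}"
    by (rule mul_indec[of _ _ UNIV]) (auto simp: supported_def union_is_single)
  then have "g {#i#} = 0" using f factors_sign[OF f, of "{#i#}"] x by (simp add: factors_def)
  moreover have "g {#i#} = dil (q i) 1" 
  proof -
    have "g (replicate_mset 1 i) = dil (q i) 1" using g unfolding good_def by blast
    then show ?thesis by simp
  qed
  moreover have "dil (q i) 1 \<noteq> 0"
  proof -
    have "q i ^ 2 > 1" using q_gt_1[of i] by (intro one_less_power) auto
    then have "1 / q i ^ 2 - 1 \<noteq> 0" by (simp add: field_simps)
    then show ?thesis using q_gt_1[of i] by simp
  qed
  ultimately show False by simp
qed

lemma wall_free_positive: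
  assumes "g {#} = 1" "\<And>i. x i > 0"
  shows "wall_free w x g"
proof -
  have "m \<in> pset x" for m
  proof (cases m)
    case (add i m')
    have "wt x m' \<ge> 0" by (rule wt_nonneg) (simp add: assms(2) less_imp_le)
    then show ?thesis using assms(2)[of i] by (simp add: add pset_def)
  qed (simp add: pset_def)
  then have "supported g (pset x)" by (simp add: supported_def)
  then have "factors w x g g one one"
    using assms(1) supported_one[OF submonoid_sets(2)[of x]] supported_one[OF submonoid_sets(3)[of x]] by (simp add: factors_def)
  then show ?thesis by (auto simp: wall_free_def)
qed

subsection \<open>Sign-coherence\<close>

text \<open>A mixed-sign coefficient vector would vanish at some positive integral point.\<close>

lemma nonvanishing_coherent:
  fixes c :: "'a \<Rightarrow> int"
  assumes nz: "\<And>x. (\<And>i. x i > 0) \<Longrightarrow> (\<Sum>l\<in>I. x l * c l) \<noteq> 0" and "finite I"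
  shows "(\<exists>i\<in>I. c i \<noteq> 0) \<and> ((\<forall>i\<in>I. c i \<ge> 0) \<or> (\<forall>i\<in>I. c i \<le> 0))"
proof
  define s where "s = (\<Sum>l\<in>I. c l)"
  have s: "s \<noteq> 0" using nz[of "\<lambda>_. 1"] by (simp add: s_def)
  then show "\<exists>i\<in>I. c i \<noteq> 0" unfolding s_def by (metis sum.neutral)
  have lin: "(\<Sum>l\<in>I. (A + (if l = p then u else 0)) * c l) = A * s + u * c p" if "p \<in> I" for A u p
  proof -
    have "(\<Sum>l\<in>I. (A + (if l = p then u else 0)) * c l) = (\<Sum>l\<in>I. A * c l + (if l = p then u * c l else 0))"
      by (intro sum.cong) (auto simp: algebra_simps)
    also have "\<dots> = A * s + u * c p"
      using that assms(2) by (simp add: sum.distrib sum_distrib_left s_def)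
    finally show ?thesis .
  qed
  show "(\<forall>i\<in>I. c i \<ge> 0) \<or> (\<forall>i\<in>I. c i \<le> 0)"
  proof (rule ccontr)
    assume "\<not> ((\<forall>i\<in>I. c i \<ge> 0) \<or> (\<forall>i\<in>I. c i \<le> 0))"
    then obtain p r where p: "p \<in> I" "c p > 0" and r: "r \<in> I" "c r < 0" by (auto simp: not_le)
    show False
    proof (cases "s > 0")
      case True
      \<comment> \<open>The point is - c_r everywhere with s added at r; its pairing with c is - c_r
        s + s c_r = 0. The other case is the same with c_p and - s.\<close>
      then have "- c r + (if i = r then s else 0) > 0" for i using r by simp
      from nz[OF this] lin[OF r(1), of "- c r" s] show False by simp
    next
      case False
      then have "c p + (if i = p then - s else 0) > 0" for i using p by simp
      from nz[OF this] lin[OF p(1), of "c p" "- s"] show False by simp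
    qed
  qed
qed

section \<open>Tropical y-variables evaluated at a point\<close>

text \<open>The term s = 0 has all exponents 0 and no term has a negative exponent at a frozen
  generator, so the minimum has no frozen part. In the y-exponents s * c is linear in s and minimal
  at one of the ends.\<close>

lemma zsum_fold:
  assumes "snd y = (\<lambda>_ _. 0)"
  shows "fold tplus (map (\<lambda>s. tmul (zgen d k s) (tpow y (int s))) [1..<m + 1]) (tmul (zgen d k 0) (tpow y 0))
    = (\<lambda>i. min 0 (int m * fst y i), \<lambda>_ _. 0)"
proof (induction m)
  case 0
  show ?case by (simp add: tmul_def zgen_def tone_def tpow_def)
next
  case (Suc m)
  let ?F = "\<lambda>s. tmul (zgen d k s) (tpow y (int s))" and ?a = "tmul (zgen d k 0) (tpow y 0)"
  have "min (int (Suc m) * a) (min 0 (int m * a)) = min 0 (int (Suc m) * a)" for a :: int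
  proof (cases "a \<ge> 0")
    case False
    then have "int m * a \<le> 0" "int (Suc m) * a \<le> int m * a"
      by (auto simp: mult_le_0_iff distrib_right)
    then show ?thesis by simp
  qed simp
  moreover have "fst (zgen d k s) i = 0" "snd (zgen d k s) i j \<ge> 0" for s i j
    by (simp_all add: zgen_def tone_def)
  ultimately have "tplus (?F (Suc m)) (\<lambda>i. min 0 (int m * fst y i), \<lambda>_ _. 0) = (\<lambda>i. min 0 (int (Suc m) * fst y i), \<lambda>_ _. 0)"
    using assms by (simp add: tplus_def tmul_def tpow_def del: of_nat_Suc)
  moreover have "fold tplus (map ?F [1..<Suc m + 1]) ?a = tplus (?F (Suc m)) (fold tplus (map ?F [1..<m + 1]) ?a)"
    by simp
  ultimately show ?case unfolding Suc by simp
qed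

lemma zsum_eq:
  "snd y = (\<lambda>_ _. 0) \<Longrightarrow> zsum d y k = (\<lambda>i. min 0 (int (d k) * fst y i), \<lambda>_ _. 0)"
  unfolding zsum_def by (rule zsum_fold)

text \<open>The $(\mathbf d,\mathbf z)$-mutation of $B$ is the ordinary mutation of the matrix $(d_i b_{ij})$, here
  extended by zero to all of \<^typ>\<open>nat\<close>.\<close>

definition ext_mat :: "nat \<Rightarrow> (nat \<Rightarrow> nat) \<Rightarrow> (nat \<Rightarrow> nat \<Rightarrow> int) \<Rightarrow> nat \<Rightarrow> nat \<Rightarrow> int" where
  "ext_mat n d B i j = (if i \<in> {1..n} \<and> j \<in> {1..n} then int (d i) * B i j else 0)"

text \<open>Outside \<open>{1..n}\<close> the point is left alone, in accordance with the zero rows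
  of \<open>ext_mat\<close>; at the initial vertex the result is thus \<open>x\<close> on all
  indices.\<close>

definition eval_y :: "nat \<Rightarrow> (nat \<Rightarrow> int) \<Rightarrow> (nat \<Rightarrow> trop) \<Rightarrow> nat \<Rightarrow> int" where
  "eval_y n x y i = (if i \<in> {1..n} then \<Sum>l\<in>{1..n}. x l * fst (y i) l else x i)"

text \<open>A symmetrizer of (d_i b_ij) is \<delta>_i / d_i; multiplying by the product of all d_l
  makes it integral. The value 1 elsewhere only has to be positive.\<close>

lemma seed_ext_mat:
  assumes "\<forall>i\<in>{1..n}. \<delta> i > 0" "\<forall>i\<in>{1..n}. \<forall>j\<in>{1..n}. \<delta> i * B i j = - (\<delta> j * B j i)"
    and "\<forall>i\<in>{1..n}. d i > 0"
  shows "seed (\<lambda>i. if i \<in> {1..n} then \<delta> i * (\<Prod>l\<in>{1..n} - {i}. int (d l)) else 1) (ext_mat n d B)"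
    (is "seed ?\<delta> _")
proof
  show "?\<delta> i > 0" for i using assms by (auto intro!: mult_pos_pos prod_pos)
  fix i j
  have *: "?\<delta> i * int (d i) = \<delta> i * (\<Prod>l\<in>{1..n}. int (d l))" if "i \<in> {1..n}" for i
    using that prod.remove[of "{1..n}" i "\<lambda>l. int (d l)"] by simp
  show "?\<delta> i * ext_mat n d B i j = - (?\<delta> j * ext_mat n d B j i)"
  proof (cases "i \<in> {1..n} \<and> j \<in> {1..n}")
    case True
    have "?\<delta> i * ext_mat n d B i j = (?\<delta> i * int (d i)) * B i j" using True by (simp add: ext_mat_def)
    also have "\<dots> = (\<Prod>l\<in>{1..n}. int (d l)) * (\<delta> i * B i j)" using True by (subst *) simp_all
    also have "\<delta> i * B i j = - (\<delta> j * B j i)" using assms(2) True by blast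
    also have "(\<Prod>l\<in>{1..n}. int (d l)) * - (\<delta> j * B j i) = - ((?\<delta> j * int (d j)) * B j i)"
      using True by (subst *) simp_all
    also have "\<dots> = - (?\<delta> j * ext_mat n d B j i)" using True by (simp add: ext_mat_def)
    finally show ?thesis .
  qed (auto simp: ext_mat_def)
qed

lemma ext_mat_mut:
  assumes "k \<in> {1..n}"
  shows "ext_mat n d (mut_matrix d k B) = mut_b k (ext_mat n d B)"
proof (intro ext)
  fix i j
  have *: "max (int (d l) * a) 0 = int (d l) * max a 0" for l a
    by (simp add: max_mult_distrib_left)
  show "ext_mat n d (mut_matrix d k B) i j = mut_b k (ext_mat n d B) i j"
    using assms *[of i "- B i k"] *[of k "B k j"]
    by (auto simp: ext_mat_def mut_matrix_def mut_b_def pos_def algebra_simps)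
qed

text \<open>\<^term>\<open>eval_y n x y\<close> pairs the exponents of the $y$-variables with the point \<^term>\<open>x\<close>. Only where the
  column \<^term>\<open>k\<close> is sign-coherent, of sign \<^term>\<open>s\<close>, does this pairing commute with mutation at \<^term>\<open>k\<close>.\<close>

lemma eval_y_mut:
  assumes k: "k \<in> {1..n}" and z: "snd (y k) = (\<lambda>_ _. 0)"
    and c: "(\<forall>l\<in>{1..n}. fst (y k) l \<ge> 0) \<and> s = 1 \<or> (\<forall>l\<in>{1..n}. fst (y k) l \<le> 0) \<and> s = -1"
  shows "eval_y n x (mut_y d k B y) =
    (\<lambda>i. if i = k then - eval_y n x y k else eval_y n x y i + max (s * ext_mat n d B k i) 0 * eval_y n x y k)"
proof
  fix i
  consider "i = k" | "i \<notin> {1..n}" | "i \<in> {1..n}" "i \<noteq> k" by blast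
  then show "eval_y n x (mut_y d k B y) i =
    (if i = k then - eval_y n x y k else eval_y n x y i + max (s * ext_mat n d B k i) 0 * eval_y n x y k)"
  proof cases
    case 1
    then show ?thesis using k by (simp add: eval_y_def mut_y_def tpow_def sum_negf)
  next
    case 2
    then show ?thesis using k by (auto simp: eval_y_def ext_mat_def)
  next
    case 3
    have "max (s * (int (d k) * B k i)) 0 = int (d k) * max (s * B k i) 0"
      by (simp add: max_mult_distrib_left mult.left_commute)
    then have m: "max (s * ext_mat n d B k i) 0 = int (d k) * max (s * B k i) 0"
      using k 3 by (simp add: ext_mat_def)
    have "fst (mut_y d k B y i) l = fst (y i) l + int (d k) * max (s * B k i) 0 * fst (y k) l" if "l \<in> {1..n}" for l
    proof -
      have "fst (mut_y d k B y i) l = fst (y i) l + int (d k) * (max (B k i) 0 * fst (y k) l) - B k i * min 0 (int (d k) * fst (y k) l)"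
        using 3 by (simp add: mut_y_def tmul_def tpow_def zsum_eq[OF z] pos_def)
      moreover have "s = 1 \<and> min 0 (int (d k) * fst (y k) l) = 0 \<or>
          s = -1 \<and> min 0 (int (d k) * fst (y k) l) = int (d k) * fst (y k) l"
        using c that mult_nonneg_nonpos[of "int (d k)" "fst (y k) l"] mult_nonneg_nonneg[of "int (d k)" "fst (y k) l"]
        by auto
      moreover have mx: "max (- b) 0 = max b 0 - b" for b :: int by simp
      ultimately show ?thesis by (auto simp: mx algebra_simps)
    qed
    then have "(\<Sum>l\<in>{1..n}. x l * fst (mut_y d k B y i) l)
      = (\<Sum>l\<in>{1..n}. x l * fst (y i) l + int (d k) * max (s * B k i) 0 * (x l * fst (y k) l))"
      by (intro sum.cong) (auto simp: algebra_simps)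
    then show ?thesis using 3 k
      by (simp add: eval_y_def m sum.distrib sum_distrib_left)
  qed
qed

text \<open>The induction invariant. The series is chosen before \<open>x\<close>, because coherence
  of the mutating column needs nonvanishing at all positive points of the same seed.\<close>

lemma principal_seed_wall_free:
  fixes \<delta> :: "nat \<Rightarrow> int"
  assumes sd: "seed \<delta> (ext_mat n d B)" and ks: "set ks \<subseteq> {1..n}"
  defines "S \<equiv> principal_seed d B ks"
  shows "(\<forall>i. snd (snd S i) = (\<lambda>_ _. 0)) \<and> seed \<delta> (ext_mat n d (fst S)) \<and>
    (\<exists>g. good \<delta> (ext_mat n d (fst S)) g \<and>
      (\<forall>x. (\<forall>i. x i > 0) \<longrightarrow> wall_free (symm_form \<delta> (ext_mat n d (fst S))) (eval_y n x (snd S)) g))"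
  using ks unfolding S_def
proof (induction ks rule: rev_induct)
  case Nil
  obtain g where g: "good \<delta> (ext_mat n d B) g" using seed.good_exists[OF sd] by blast
  have snd_ygen: "snd (ygen i) = (\<lambda>_ _. 0)" for i by (simp add: ygen_def)
  have "eval_y n x ygen = x" for x
    by (rule ext) (simp add: eval_y_def ygen_def if_distrib cong: if_cong)
  then show ?case
    using sd g wall_free_positive[of g] seed.good_empty[OF sd g]
    by (auto simp: principal_seed_def snd_ygen)
next
  case (snoc k ks)
  define Bt where "Bt = fst (principal_seed d B ks)"
  define y where "y = snd (principal_seed d B ks)"
  have k: "k \<in> {1..n}" using snoc.prems by simp
  from snoc obtain g where z: "\<And>i. snd (y i) = (\<lambda>_ _. 0)" and sd': "seed \<delta> (ext_mat n d Bt)"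
    and g: "good \<delta> (ext_mat n d Bt) g"
    and t: "\<And>x. (\<And>i. x i > 0) \<Longrightarrow> wall_free (symm_form \<delta> (ext_mat n d Bt)) (eval_y n x y) g"
    unfolding Bt_def y_def by auto
  interpret seed \<delta> "ext_mat n d Bt" by (rule sd')
  have nz: "eval_y n x y k \<noteq> 0" if "\<And>i. x i > 0" for x
    by (rule wall_free_nonzero[OF g]) (rule t[OF that])
  have S: "principal_seed d B (ks @ [k]) = (mut_matrix d k Bt, mut_y d k Bt y)"
    by (simp add: principal_seed_def mut_seed_def Bt_def y_def)
  \<comment> \<open>Coherence gives \<open>eval_y n x y k\<close> the same sign for every positive
    \<open>x\<close>, and this sign selects the branch of tropical mutation that the y-variables
    follow.\<close>
  have coh: "(\<forall>l\<in>{1..n}. fst (y k) l \<ge> 0) \<or> (\<forall>l\<in>{1..n}. fst (y k) l \<le> 0)"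
  proof (rule conjunct2[OF nonvanishing_coherent])
    fix x :: "nat \<Rightarrow> int" assume "\<And>i. x i > 0"
    from nz[of x, OF this] show "(\<Sum>l\<in>{1..n}. x l * fst (y k) l) \<noteq> 0"
      using k by (simp add: eval_y_def)
  qed simp
  have "wall_free (w' k) (eval_y n x (mut_y d k Bt y)) (mut_series \<delta> (ext_mat n d Bt) k g)" if x: "\<And>i. x i > 0" for x
    using coh
  proof
    assume c: "\<forall>l\<in>{1..n}. fst (y k) l \<ge> 0"
    have "eval_y n x y k \<ge> 0" using k c x by (auto simp: eval_y_def less_imp_le intro!: sum_nonneg)
    then have "eval_y n x y k > 0" using nz[of x, OF x] by simp
    from wall_free_up[OF g t[of x, OF x] this] show ?thesis
      using eval_y_mut[where s = 1 and x = x and d = d and B = Bt and y = y, OF k z] c by (simp add: trop_up_def[abs_def] cong: if_cong)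
  next
    assume c: "\<forall>l\<in>{1..n}. fst (y k) l \<le> 0"
    have "eval_y n x y k \<le> 0" using k c x by (auto simp: eval_y_def less_imp_le mult_nonneg_nonpos intro!: sum_nonpos)
    then have "eval_y n x y k < 0" using nz[of x, OF x] by simp
    from wall_free_down[OF g t[of x, OF x] this] show ?thesis
      using eval_y_mut[where s = "-1" and x = x and d = d and B = Bt and y = y, OF k z] c by (simp cong: if_cong)
  qed
  moreover have "snd (mut_y d k Bt y i) = (\<lambda>_ _. 0)" for i
    using z by (simp add: mut_y_def tmul_def tpow_def zsum_eq fun_eq_iff)
  ultimately show ?case
    using mut_b_seed[of k] good_mut_series[OF g, of k] by (auto simp: S ext_mat_mut[OF k])
qed

theorem mainTheorem15:
  fixes n :: nat and B :: "nat \<Rightarrow> nat \<Rightarrow> int" and d :: "nat \<Rightarrow> nat"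
    and ks :: "nat list" and j :: nat
  assumes "skew_symmetrizable n B"
    and "\<forall>i\<in>{1..n}. d i > 0"
    and "tree_vertex n ks"
    and "j \<in> {1..n}"
  shows "(\<exists>i\<in>{1..n}. c_vector d B ks j i \<noteq> 0) \<and>
         ((\<forall>i\<in>{1..n}. c_vector d B ks j i \<ge> 0) \<or> (\<forall>i\<in>{1..n}. c_vector d B ks j i \<le> 0))"
proof (rule nonvanishing_coherent)
  fix x :: "nat \<Rightarrow> int" assume x: "\<And>i. x i > 0"
  obtain \<delta> where "\<forall>i\<in>{1..n}. \<delta> i > 0" "\<forall>i\<in>{1..n}. \<forall>j\<in>{1..n}. \<delta> i * B i j = - (\<delta> j * B j i)"
    using assms(1) unfolding skew_symmetrizable_def by blast
  then obtain \<delta>' where sd: "seed \<delta>' (ext_mat n d B)" using seed_ext_mat assms(2) by blast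
  have "set ks \<subseteq> {1..n}" using assms(3) by (simp add: tree_vertex_def)
  from principal_seed_wall_free[OF sd this] obtain g
    where "seed \<delta>' (ext_mat n d (fst (principal_seed d B ks)))" "good \<delta>' (ext_mat n d (fst (principal_seed d B ks))) g"
      and t: "\<forall>x. (\<forall>i. x i > 0) \<longrightarrow>
        wall_free (symm_form \<delta>' (ext_mat n d (fst (principal_seed d B ks)))) (eval_y n x (snd (principal_seed d B ks))) g"
    by blast
  from seed.wall_free_nonzero[OF this(1,2), where x = "eval_y n x (snd (principal_seed d B ks))" and i = j] t x
  show "(\<Sum>l\<in>{1..n}. x l * c_vector d B ks j l) \<noteq> 0"
    using assms(4) by (simp add: eval_y_def c_vector_def)
qed simp

end
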